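(* Let $q$ be a power of $2$, let $m$ be an even positive integer, and let $a\in\mathbb{F}_q^*$. Let $f$ be a non-degenerate quadratic form over $\mathbb{F}_{q^m}$ which is equivalent to Type II. Let $D_f=\{x\in\mathbb{F}_{q^m}: f(x)=a\}$ and let $\mathcal{C}_{D_f}=\{(\mathrm{Tr}(xd))_{d\in D_f}: x\in\mathbb{F}_{q^m}\}$, a linear code over $\mathbb{F}_q$ of length $|D_f|$. Then $\mathcal{C}_{D_f}$ has the following weight hierarchy: $$d_r(\mathcal{C}_{D_f})=\begin{cases} q^{m-1}-q^{m-r-1}, & \text{if } 1\le r\le \frac{m}{2}-1,\\ q^{m-1}+q^{\frac{m-2}{2}}-q^{m-r-1}-q^{m-r-2}, & \text{if } \frac{m}{2}\le r<m-1,\\ q^{m-1}+q^{\frac{m-2}{2}}-1, & \text{if } r=m-1,\\ q^{m-1}+q^{\frac{m-2}{2}}, & \text{if } r=m.\end{cases}$$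
   Context: $\mathrm{Tr}$ is the trace from $\mathbb{F}_{q^m}$ to $\mathbb{F}_q$. Generalized Hamming weights: for a $k$-dimensional linear code $\mathcal{C}\subseteq\mathbb{F}_q^n$ and an $\mathbb{F}_q$-subspace $H$ of $\mathcal{C}$, $\mathrm{supp}(H)=\{i: c_i\ne 0 \text{ for some } (c_1,\dots,c_n)\in H\}$. For $1\le r\le k$, $d_r(\mathcal{C})=\min\{|\mathrm{supp}(H)| : H \text{ an } r\text{-dimensional subspace of } \mathcal{C}\}$; the set $\{d_1(\mathcal C),\dots,d_k(\mathcal C)\}$ is the weight hierarchy of $\mathcal{C}$. Quadratic forms: fix a basis $\varepsilon_1,\dots,\varepsilon_m$ of $\mathbb{F}_{q^m}$ over $\mathbb{F}_q$ and identify $x=\sum x_i\varepsilon_i$ with $(x_1,\dots,x_m)\in\mathbb{F}_q^m$. A quadratic form over $\mathbb{F}_{q^m}$ is a map $f:\mathbb{F}_{q^m}\to\mathbb{F}_q$ of the form $f(x)=\sum_{1\le i\le j\le m}a_{ij}x_ix_j$ with $a_{ij}\in\mathbb{F}_q$. Put $\ker f=\{x\in\mathbb{F}_{q^m}: f(x+y)=f(y)\text{ for all }y\in\mathbb{F}_{q^m}\}$ (an $\mathbb{F}_q$-subspace). $f$ is non-degenerate if $\ker f=\{0\}$, and degenerate otherwise; $\mathrm{rank}\, f=m-\dim_{\mathbb{F}_q}\ker f$. Types: a quadratic form of rank $t$ is equivalent, under an invertible $\mathbb{F}_q$-linear change of coordinates, to exactly one of: Type I ($t$ even): $x_1x_2+x_3x_4+\cdots+x_{t-1}x_t$;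 Type II ($t$ even): $x_1x_2+\cdots+x_{t-3}x_{t-2}+\alpha x_{t-1}^2+x_{t-1}x_t+\alpha x_t^2$ with $\alpha\in\mathbb{F}_q\setminus\{x^2+x: x\in\mathbb{F}_q\}$; Type III ($t$ odd): $x_1x_2+\cdots+x_{t-2}x_{t-1}+x_t^2$. *)

theory Defs
  imports Complex_Main "HOL-Library.Function_Algebras" "HOL-Library.Cardinality"
begin

text \<open>
  The extension of finite fields is given by a ring homomorphism \<open>emb\<close> (automatically injective) from
  a finite field of type \<open>'k\<close>, with \<open>q\<close> elements, to a finite field of type \<open>'l\<close>, with \<open>q ^ m\<close>
  elements. All linear algebra over \<open>'k\<close> is the library's, taken with respect to the scalar
  multiplications \<open>ext_scale emb\<close> on \<open>'l\<close> and \<open>fun_scale\<close> on words.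
\<close>

definition field_embedding :: "('k::field \<Rightarrow> 'l::field) \<Rightarrow> bool" where
  "field_embedding emb \<longleftrightarrow>
     emb 1 = 1 \<and> (\<forall>x y. emb (x + y) = emb x + emb y) \<and> (\<forall>x y. emb (x * y) = emb x * emb y)"

definition ext_scale :: "('k::field \<Rightarrow> 'l::field) \<Rightarrow> 'k \<Rightarrow> 'l \<Rightarrow> 'l" where
  "ext_scale emb c x = emb c * x"

definition fun_scale :: "'k::field \<Rightarrow> ('i \<Rightarrow> 'k) \<Rightarrow> ('i \<Rightarrow> 'k)" where
  "fun_scale c w = (\<lambda>i. c * w i)"

lemma vector_space_ext_scale:
  assumes "field_embedding emb"
  shows "vector_space (ext_scale emb)"
  using assms by unfold_locales (simp_all add: ext_scale_def field_embedding_def algebra_simps)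

lemma vector_space_fun_scale: "vector_space fun_scale"
  by unfold_locales (simp_all add: fun_scale_def algebra_simps fun_eq_iff)

text \<open>
  The trace is the sum of the conjugates, an element of the image of \<open>emb\<close>, read as an element of
  \<open>'k\<close>.
\<close>

definition ext_trace :: "('k::{field,finite} \<Rightarrow> 'l::field) \<Rightarrow> nat \<Rightarrow> 'l \<Rightarrow> 'k" where
  "ext_trace emb m x = the_inv emb (\<Sum>i<m. x ^ (CARD('k) ^ i))"

definition indexed_basis :: "('k::field \<Rightarrow> 'l::field) \<Rightarrow> nat \<Rightarrow> (nat \<Rightarrow> 'l) \<Rightarrow> bool" where
  "indexed_basis emb m e \<longleftrightarrow>
     inj_on e {1..m} \<and>
     \<not> module.dependent (ext_scale emb) (e ` {1..m}) \<and>
     module.span (ext_scale emb) (e ` {1..m}) = UNIV"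

definition coordinate :: "('k::field \<Rightarrow> 'l::field) \<Rightarrow> nat \<Rightarrow> (nat \<Rightarrow> 'l) \<Rightarrow> 'l \<Rightarrow> nat \<Rightarrow> 'k" where
  "coordinate emb m e x i = module.representation (ext_scale emb) (e ` {1..m}) x (e i)"

definition quadratic_form ::
    "('k::field \<Rightarrow> 'l::field) \<Rightarrow> nat \<Rightarrow> (nat \<Rightarrow> 'l) \<Rightarrow> ('l \<Rightarrow> 'k) \<Rightarrow> bool" where
  "quadratic_form emb m e f \<longleftrightarrow>
     (\<exists>A :: nat \<Rightarrow> nat \<Rightarrow> 'k. \<forall>x. f x =
        (\<Sum>i=1..m. \<Sum>j=i..m. A i j * coordinate emb m e x i * coordinate emb m e x j))"

definition form_ker :: "('l::field \<Rightarrow> 'k::field) \<Rightarrow> 'l set" where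
  "form_ker f = {x. \<forall>y. f (x + y) = f y}"

definition nondegenerate :: "('l::field \<Rightarrow> 'k::field) \<Rightarrow> bool" where
  "nondegenerate f \<longleftrightarrow> form_ker f = {0}"

definition form_rank :: "('k::field \<Rightarrow> 'l::field) \<Rightarrow> nat \<Rightarrow> ('l \<Rightarrow> 'k) \<Rightarrow> nat" where
  "form_rank emb m f = m - vector_space.dim (ext_scale emb) (form_ker f)"

definition form_equiv ::
    "('k::field \<Rightarrow> 'l::field) \<Rightarrow> ('l \<Rightarrow> 'k) \<Rightarrow> ('l \<Rightarrow> 'k) \<Rightarrow> bool" where
  "form_equiv emb f g \<longleftrightarrow>
     (\<exists>T. Vector_Spaces.linear (ext_scale emb) (ext_scale emb) T \<and> bij T \<and> (\<forall>x. f x = g (T x)))"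

definition type_II_poly :: "nat \<Rightarrow> 'k::field \<Rightarrow> (nat \<Rightarrow> 'k) \<Rightarrow> 'k" where
  "type_II_poly t \<alpha> x =
     (\<Sum>i=1..(t - 2) div 2. x (2 * i - 1) * x (2 * i)) +
     \<alpha> * x (t - 1) ^ 2 + x (t - 1) * x t + \<alpha> * x t ^ 2"

definition is_type_II ::
    "('k::field \<Rightarrow> 'l::field) \<Rightarrow> nat \<Rightarrow> (nat \<Rightarrow> 'l) \<Rightarrow> ('l \<Rightarrow> 'k) \<Rightarrow> bool" where
  "is_type_II emb m e f \<longleftrightarrow>
     even (form_rank emb m f) \<and> 2 \<le> form_rank emb m f \<and>
     (\<exists>\<alpha> \<in> - range (\<lambda>x :: 'k. x ^ 2 + x).
        form_equiv emb f (\<lambda>x. type_II_poly (form_rank emb m f) \<alpha> (coordinate emb m e x)))"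

text \<open>
  Words with coordinates indexed by a set \<open>D\<close> are functions that vanish outside \<open>D\<close>, so that they
  form a subspace of the function space and the coordinates outside \<open>D\<close> never occur in a support.
\<close>

definition defining_set :: "('l \<Rightarrow> 'k) \<Rightarrow> 'k \<Rightarrow> 'l set" where
  "defining_set f a = {x. f x = a}"

definition trace_code ::
    "('k::{field,finite} \<Rightarrow> 'l::field) \<Rightarrow> nat \<Rightarrow> 'l set \<Rightarrow> ('l \<Rightarrow> 'k) set" where
  "trace_code emb m D = range (\<lambda>x d. if d \<in> D then ext_trace emb m (x * d) else 0)"

definition code_supp :: "('i \<Rightarrow> 'k::zero) set \<Rightarrow> 'i set" where
  "code_supp H = {i. \<exists>c\<in>H. c i \<noteq> 0}"

definition gen_hamming_weight :: "('i \<Rightarrow> 'k::field) set \<Rightarrow> nat \<Rightarrow> nat" where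
  "gen_hamming_weight C r =
     Min {card (code_supp H) | H.
            module.subspace fun_scale H \<and> H \<subseteq> C \<and> vector_space.dim fun_scale H = r}"

end

theory Submission
  imports Defs "HOL-Computational_Algebra.Polynomial" "HOL-Library.FuncSet"
begin

text \<open>
  With an additive character \<open>\<psi>\<close> of the base field put \<open>S W = (\<Sum>x\<in>W. \<psi> (f x))\<close>; a subspace \<open>W\<close> then
  contains \<open>(card W - S W) / q\<close> points with \<open>f x = a\<close>. A subspace of dimension \<open>r\<close> of the code has as
  support the points of the defining set outside a subspace of dimension \<open>m - r\<close> (an orthogonal
  complement for the trace form), so \<open>d\<^sub>r\<close> amounts to minimising \<open>S\<close> in dimension \<open>m - r\<close>. From
  \<open>(S W)\<^sup>2 = card W * S (radical W)\<close> one gets \<open>S W \<ge> - q ^ (m div 2)\<close>, as the radical lies in the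
  orthogonal complement of \<open>W\<close>, and \<open>q * S W \<ge> - card W\<close>, as the radical of an alternating form
  has codimension \<open>0\<close> or at least \<open>2\<close>. Coordinate subspaces attain these bounds: the orthogonal
  complement of a totally singular subspace for the first, the sum of a totally singular subspace
  and the anisotropic plane for the second.
\<close>

section \<open>Finite fields of characteristic two\<close>

text \<open>Multiplying all units by \<open>x\<close> permutes them, so their product absorbs a
  factor \<open>x ^ card ?U\<close>, which must be 1.\<close>

lemma finite_field_power_CARD:
  fixes x :: "'a::{field,finite}"
  shows "x ^ CARD('a) = x"
proof (cases "x = 0")
  case False
  let ?U = "UNIV - {0 :: 'a}"
  have "(\<Prod>y\<in>?U. y) = (\<Prod>y\<in>?U. x * y)"
    by (rule prod.reindex_bij_witness[of _ "\<lambda>y. x * y" "\<lambda>y. y / x"]) (use False in auto)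
  also have "\<dots> = x ^ card ?U * (\<Prod>y\<in>?U. y)"
    unfolding prod.distrib prod_constant ..
  finally have "1 * (\<Prod>y\<in>?U. y) = x ^ card ?U * (\<Prod>y\<in>?U. y)"
    by (simp only: mult_1)
  moreover have "(\<Prod>y\<in>?U. y) \<noteq> 0"
    by simp
  ultimately have "x ^ card ?U = 1"
    by (simp only: mult_cancel_right simp_thms)
  moreover have "CARD('a) = Suc (card ?U)"
    by (rule card.remove) simp_all
  ultimately have "x ^ CARD('a) = x * 1"
    by (simp only: power_Suc)
  then show ?thesis
    by simp
qed (simp add: power_0_left)

text \<open>The shift by 1 permutes the ring and so preserves the sum of all its elements, although
  it adds 1 to each.\<close>

lemma of_nat_CARD_eq_0: "of_nat CARD('a::{ring_1,finite}) = (0 :: 'a)"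
proof -
  have "(\<Sum>y\<in>UNIV. y) = (\<Sum>y\<in>UNIV. y + (1 :: 'a))"
    by (rule sum.reindex_bij_witness[of _ "\<lambda>y. y + 1" "\<lambda>y. y - 1"]) auto
  then show ?thesis
    by (simp add: sum.distrib)
qed

lemma CARD_ge_2: "2 \<le> CARD('a::{zero_neq_one,finite})"
proof -
  have "card {0, 1 :: 'a} \<le> CARD('a)"
    by (rule card_mono) simp_all
  then show ?thesis
    by simp
qed

lemma two_eq_0_if_CARD_power2:
  assumes "CARD('a::{field,finite}) = 2 ^ n"
  shows "(2 :: 'a) = 0"
proof -
  have "(2 :: 'a) ^ n = 0"
    using of_nat_CARD_eq_0[where ?'a = 'a] assms by simp
  then show ?thesis
    by simp
qed

lemma power2_add_char2:
  fixes x y :: "'a::comm_ring_1"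
  assumes "(2 :: 'a) = 0"
  shows "(x + y) ^ 2 ^ n = x ^ 2 ^ n + y ^ 2 ^ n"
proof (induction n)
  case (Suc n)
  have "(x + y) ^ 2 ^ Suc n = (x ^ 2 ^ n + y ^ 2 ^ n)\<^sup>2"
    by (simp add: mult.commute[of 2] power_mult Suc)
  then show ?case
    by (simp add: power2_sum assms mult.commute[of 2] power_mult)
qed simp

text \<open>Each new independent vector multiplies the size of the span by the size of the field.
  Subspaces can then be handled through cardinalities.\<close>

lemma card_subspace:
  fixes scale :: "'k::{field,finite} \<Rightarrow> 'v::ab_group_add \<Rightarrow> 'v"
  assumes "vector_space scale" and S: "module.subspace scale S" and fin: "finite S"
  shows "card S = CARD('k) ^ vector_space.dim scale S"
proof -
  interpret vector_space scale by fact
  have card_span: "card (span B) = CARD('k) ^ card B" if "finite B" "independent B" for B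
    using that
  proof (induction B rule: finite_induct)
    case (insert b B)
    have b: "b \<notin> span B" and B: "independent B"
      using insert by (auto simp: independent_insert split: if_splits)
    have "bij_betw (\<lambda>(c, x). scale c b + x) (UNIV \<times> span B) (span (insert b B))"
      unfolding bij_betw_def
    proof
      show "inj_on (\<lambda>(c, x). scale c b + x) (UNIV \<times> span B)"
      proof (intro inj_onI, clarify)
        fix c x d y
        assume xy: "x \<in> span B" "y \<in> span B" and eq: "scale c b + x = scale d b + y"
        have "scale (c - d) b = y - x"
          using eq by (simp add: algebra_simps)
        then have "scale (c - d) b \<in> span B"
          using xy by (simp add: span_diff)
        then have "scale (inverse (c - d)) (scale (c - d) b) \<in> span B"
          by (rule span_scale)
        then have "c = d"
          using b by (cases "c = d") auto
        with eq show "c = d \<and> x = y"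
          by simp
      qed
      show "(\<lambda>(c, x). scale c b + x) ` (UNIV \<times> span B) = span (insert b B)"
      proof (intro equalityI subsetI)
        fix z assume "z \<in> (\<lambda>(c, x). scale c b + x) ` (UNIV \<times> span B)"
        then obtain c x where "z = scale c b + x" "x \<in> span B"
          by auto
        moreover have "x \<in> span (insert b B)"
          using calculation span_mono[of B "insert b B"] by blast
        ultimately show "z \<in> span (insert b B)"
          by (simp add: span_add span_scale span_base)
      next
        fix z assume "z \<in> span (insert b B)"
        then obtain c where "z - scale c b \<in> span B"
          by (auto simp: span_insert)
        then show "z \<in> (\<lambda>(c, x). scale c b + x) ` (UNIV \<times> span B)"
          by (intro image_eqI[of _ _ "(c, z - scale c b)"]) auto
      qed
    qed
    then have "card (span (insert b B)) = CARD('k) * card (span B)"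
      by (simp add: bij_betw_same_card[symmetric] card_cartesian_product)
    then show ?case
      using insert B by simp
  qed simp
  obtain B where B: "B \<subseteq> S" "independent B" "S \<subseteq> span B" "card B = dim S"
    using basis_exists by blast
  then have "span B = S"
    using S span_minimal by blast
  then show ?thesis
    using card_span[of B] B finite_subset[OF B(1) fin] by simp
qed


section \<open>Quadratic character sums\<close>

text \<open>In characteristic two additive characters take only the values 1 and -1, so integer
  values suffice. Together with nontriviality, \<open>psi_square\<close> singles out the character
  given by -1 to the power of the absolute trace.\<close>

locale binary_character =
  fixes \<psi> :: "'k::{field,finite} \<Rightarrow> int"
  assumes char2: "(2 :: 'k) = 0"
    and psi_add: "\<psi> (x + y) = \<psi> x * \<psi> y"
    and psi_square: "\<psi> (x\<^sup>2) = \<psi> x"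
    and psi_values: "\<psi> x = 1 \<or> \<psi> x = - 1"
    and psi_nontrivial: "\<exists>x. \<psi> x = - 1"
begin

lemma add_self [simp]: "x + x = (0 :: 'k)"
  using mult_2[of x] by (simp add: char2)

lemma add_self_left [simp]: "x + (x + y) = (y :: 'k)"
  unfolding add.assoc[symmetric] by simp

lemma square_add: "(x + y)\<^sup>2 = x\<^sup>2 + (y\<^sup>2 :: 'k)"
  by (simp add: power2_sum char2)

lemma psi_0 [simp]: "\<psi> 0 = 1"
proof -
  have "\<psi> 0 = \<psi> 0 * \<psi> 0"
    using psi_add[of 0 0] by (simp only: add_0)
  then show ?thesis
    using psi_values[of 0] by (elim disjE) simp_all
qed

lemma psi_le_1: "\<psi> x \<le> 1"
  using psi_values[of x] by auto

lemma psi_sum: "\<psi> (sum g A) = (\<Prod>i\<in>A. \<psi> (g i))"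
  by (induction A rule: infinite_finite_induct) (simp_all add: psi_add)

text \<open>In characteristic two squaring is additive with trivial kernel, hence injective, hence
  onto the finite field.\<close>

lemma ex_sqrt: "\<exists>y :: 'k. y\<^sup>2 = x"
proof -
  have "inj (\<lambda>y :: 'k. y\<^sup>2)"
  proof (rule injI)
    fix u v :: 'k
    assume "u\<^sup>2 = v\<^sup>2"
    then have "(u + v)\<^sup>2 = 0"
      by (simp add: square_add)
    then have "u + v = 0"
      by simp
    then show "u = v"
      using add_self_left[of u v] by simp
  qed
  then show ?thesis
    using finite_UNIV_inj_surj[OF finite] unfolding surj_def by metis
qed

lemma ex_psi_mult: "u \<noteq> 0 \<Longrightarrow> \<exists>c. \<psi> (c * u) = - 1"
proof -
  assume "u \<noteq> 0"
  obtain d where "\<psi> d = - 1"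
    using psi_nontrivial by blast
  then have "\<psi> ((d / u) * u) = - 1"
    using \<open>u \<noteq> 0\<close> by simp
  then show ?thesis ..
qed

text \<open>Orthogonality of characters: if \<open>L\<close> is nonzero on \<open>W\<close>,
  rescaling gives \<open>w\<close> in \<open>W\<close> with \<open>\<psi> (L w) = - 1\<close>, and
  the shift by \<open>w\<close> turns the sum into its negative.\<close>

lemma sum_psi_linear:
  fixes scale :: "'k \<Rightarrow> 'v::{ab_group_add,finite} \<Rightarrow> 'v"
  assumes "vector_space scale" and W: "module.subspace scale W"
    and L: "\<And>x y. L (x + y) = L x + L y" "\<And>c x. L (scale c x) = c * L x"
  shows "(\<Sum>x\<in>W. \<psi> (L x)) = (if \<forall>x\<in>W. L x = 0 then int (card W) else 0)"
proof (cases "\<forall>x\<in>W. L x = 0")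
  case False
  interpret vector_space scale by fact
  obtain x where x: "x \<in> W" "L x \<noteq> 0"
    using False by auto
  obtain c where c: "\<psi> (c * L x) = - 1"
    using ex_psi_mult x by blast
  define w where "w = scale c x"
  have w: "w \<in> W" "\<psi> (L w) = - 1"
    using c x W subspace_scale by (auto simp: w_def L)
  have "(\<Sum>x\<in>W. \<psi> (L x)) = (\<Sum>x\<in>W. \<psi> (L (x + w)))"
    by (rule sum.reindex_bij_witness[of _ "\<lambda>x. x + w" "\<lambda>x. x - w"])
      (use w W in \<open>auto intro: subspace_add subspace_diff\<close>)
  also have "\<dots> = - (\<Sum>x\<in>W. \<psi> (L x))"
    by (simp add: L psi_add w sum_negf)
  finally have "(\<Sum>x\<in>W. \<psi> (L x)) = 0"
    by simp
  with False show ?thesis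
    by presburger
qed simp

lemma sum_psi_mult: "(\<Sum>c\<in>UNIV. \<psi> (c * u)) = (if u = 0 then int CARD('k) else 0)"
proof -
  have vs: "vector_space ((*) :: 'k \<Rightarrow> _)"
    by unfold_locales (simp_all add: algebra_simps)
  have "module.subspace ((*) :: 'k \<Rightarrow> _) UNIV"
    using vs by (intro module.subspace_UNIV) (simp add: module_iff_vector_space)
  from sum_psi_linear[OF vs this, of "\<lambda>c. c * u"]
  have "(\<Sum>c\<in>UNIV. \<psi> (c * u)) = (if \<forall>c\<in>UNIV. c * u = 0 then int CARD('k) else 0)"
    by (simp only: distrib_right mult.assoc)
  moreover have "(\<forall>c\<in>UNIV. c * u = 0) \<longleftrightarrow> u = 0"
    by (auto dest: spec[of _ 1])
  ultimately show ?thesis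
    by presburger
qed

text \<open>Double counting of the sum of \<open>\<psi> (B x u)\<close>: summing over
  \<open>u\<close> first leaves \<open>card U\<close> for each orthogonal \<open>x\<close>, summing
  over \<open>x\<close> first leaves only \<open>u = 0\<close>. It serves both the polar form and
  the trace form.\<close>

lemma card_orthogonal:
  fixes scale :: "'k \<Rightarrow> 'v::{ab_group_add,finite} \<Rightarrow> 'v"
  assumes "vector_space scale" and U: "module.subspace scale U"
    and B: "\<And>x y z. B (x + y) z = B x z + B y z" "\<And>c x z. B (scale c x) z = c * B x z"
      "\<And>x y z. B z (x + y) = B z x + B z y" "\<And>c x z. B z (scale c x) = c * B z x"
    and nondeg: "\<And>z. \<forall>x. B x z = 0 \<Longrightarrow> z = 0"
  shows "card U * card {x. \<forall>u\<in>U. B x u = 0} = CARD('v)"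
proof -
  interpret vector_space scale by fact
  have B0: "B x 0 = 0" for x
    using B(4)[of x 0 0] by simp
  have "(\<Sum>x\<in>UNIV. \<Sum>u\<in>U. \<psi> (B x u)) = int (card U * card {x. \<forall>u\<in>U. B x u = 0})"
  proof -
    have "(\<Sum>x\<in>UNIV. \<Sum>u\<in>U. \<psi> (B x u))
      = (\<Sum>x\<in>UNIV. if x \<in> {x. \<forall>u\<in>U. B x u = 0} then int (card U) else 0)"
      by (intro sum.cong refl) (simp add: sum_psi_linear[OF assms(1) U] B)
    then show ?thesis
      by (simp add: sum.If_cases)
  qed
  moreover have "(\<Sum>u\<in>U. \<Sum>x\<in>UNIV. \<psi> (B x u)) = int CARD('v)"
  proof -
    have "(\<Sum>u\<in>U. \<Sum>x\<in>UNIV. \<psi> (B x u)) = (\<Sum>u\<in>U. if u = 0 then int CARD('v) else 0)"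
      by (intro sum.cong refl)
        (use nondeg in \<open>auto simp: sum_psi_linear[OF assms(1) subspace_UNIV] B B0\<close>)
    then show ?thesis
      using subspace_0[OF U] by simp
  qed
  ultimately show ?thesis
    using sum.swap[of "\<lambda>x u. \<psi> (B x u)" U UNIV] by (simp only: of_nat_eq_iff)
qed

end

text \<open>The map x^2 + x is additive with kernel {0, 1}, so its range has index two and is the
  kernel of a character. The given \<open>\<alpha>\<close> makes this character nontrivial.\<close>

lemma binary_character_artin_schreier:
  fixes \<alpha> :: "'k::{field,finite}"
  assumes two: "(2 :: 'k) = 0" and \<alpha>: "\<alpha> \<notin> range (\<lambda>x. x\<^sup>2 + x)"
  shows "binary_character (\<lambda>c :: 'k. if c \<in> range (\<lambda>x. x\<^sup>2 + x) then 1 else - 1)"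
proof -
  define p where "p = (\<lambda>x :: 'k. x\<^sup>2 + x)"
  have dbl: "x + x = 0" for x :: 'k
    using two by (metis mult_2 mult_zero_left)
  have add0: "x + y = 0 \<longleftrightarrow> x = y" for x y :: 'k
    using dbl by (metis add_left_cancel)
  have p_add: "p (x + y) = p x + p y" for x y
    by (simp add: p_def power2_sum two algebra_simps)
  have P_add: "c + d \<in> range p" if "c \<in> range p" "d \<in> range p" for c d
  proof -
    obtain x y where "c = p x" "d = p y"
      using \<open>c \<in> range p\<close> \<open>d \<in> range p\<close> by blast
    then have "c + d = p (x + y)"
      by (simp add: p_add)
    then show ?thesis
      by simp
  qed
  have p_eq: "p x = p y \<longleftrightarrow> y = x \<or> y = x + 1" for x y
  proof -
    have "p x = p y \<longleftrightarrow> p (x + y) = 0"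
      unfolding p_add by (rule add0[symmetric])
    also have "p (x + y) = (x + y) * (x + y + 1)"
      by (simp add: p_def power2_eq_square distrib_left)
    also have "(x + y) * (x + y + 1) = 0 \<longleftrightarrow> x = y \<or> x + (y + 1) = 0"
      unfolding mult_eq_0_iff add0 add.assoc ..
    also have "\<dots> \<longleftrightarrow> y = x \<or> y = x + 1"
    proof -
      have "x = y + 1 \<longleftrightarrow> y = x + 1"
        using dbl[of 1] by (auto simp: add.assoc)
      then show ?thesis
        unfolding add0 by blast
    qed
    finally show ?thesis .
  qed
  have card_P: "CARD('k) = 2 * card (range p)"
  proof -
    have "card {x. p x = y} = 2" if "y \<in> range p" for y
    proof -
      obtain x where "y = p x" using \<open>y \<in> range p\<close> by auto
      then have "{x. p x = y} = {x, x + 1}"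
        using p_eq[of x] by (auto simp: eq_commute)
      then show ?thesis by simp
    qed
    moreover have "CARD('k) = (\<Sum>y\<in>range p. card {x. p x = y})"
      using sum.image_gen[of UNIV "\<lambda>_. 1 :: nat" p] by simp
    ultimately show ?thesis
      by simp
  qed
  \<comment> \<open>In index two the coset of \<open>c\<close> is the whole complement, so it
    contains \<open>d\<close>; adding \<open>c\<close> then lands in \<open>range p\<close>.\<close>
  have P_cofactor: "c + d \<in> range p" if "c \<notin> range p" "d \<notin> range p" for c d
  proof -
    have "card ((+) c ` range p) = card (range p)"
      by (simp add: card_image)
    moreover have disj: "(+) c ` range p \<inter> range p = {}"
    proof (rule ccontr)
      assume "(+) c ` range p \<inter> range p \<noteq> {}"
      then obtain u where "u \<in> range p" "c + u \<in> range p"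
        by blast
      then have "(c + u) + u \<in> range p"
        using P_add by blast
      then show False
        using that dbl by (simp add: add.assoc)
    qed
    ultimately have "card ((+) c ` range p \<union> range p) = CARD('k)"
      by (subst card_Un_disjoint) (simp_all add: card_P)
    then have "(+) c ` range p \<union> range p = UNIV"
      by (simp add: card_eq_UNIV_imp_eq_UNIV)
    with that obtain u where "u \<in> range p" "d = c + u"
      by blast
    then show ?thesis
      using dbl[of c] by (simp only: add.assoc[symmetric]) simp
  qed
  have P_add2: "c \<in> range p \<longleftrightarrow> c + d \<in> range p" if "d \<in> range p" for c d
    using that P_add[of c d] P_add[of "c + d" d] dbl by (auto simp: add.assoc)
  \<comment> \<open>\<open>c\<^sup>2\<close> and \<open>c\<close> differ by \<open>p c\<close>, so
    squaring preserves both cosets.\<close>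
  have P_square: "c\<^sup>2 \<in> range p \<longleftrightarrow> c \<in> range p" for c
  proof -
    have "p c + c = c\<^sup>2"
      using dbl by (simp add: p_def add.assoc)
    then show ?thesis
      using P_add2[of "p c" c] by (metis add.commute rangeI)
  qed
  have "c + d \<in> range p \<longleftrightarrow> (c \<in> range p \<longleftrightarrow> d \<in> range p)" for c d
    using P_add2 P_cofactor by (metis add.commute)
  then show ?thesis
    unfolding binary_character_def p_def[symmetric]
    using two P_square \<alpha>[folded p_def] by auto
qed

section \<open>Quadratic forms in characteristic two and their character sums over subspaces\<close>

locale quadratic_space = vector_space scale + binary_character \<psi>
  for scale :: "'k::{field,finite} \<Rightarrow> 'v::{ab_group_add,finite} \<Rightarrow> 'v"
    and \<psi> :: "'k \<Rightarrow> int" +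
  fixes f :: "'v \<Rightarrow> 'k" and b :: "'v \<Rightarrow> 'v \<Rightarrow> 'k"
  assumes f_add: "f (x + y) = f x + f y + b x y"
    and f_scale: "f (scale c x) = c\<^sup>2 * f x"
    and b_add: "b (x + y) z = b x z + b y z"
    and b_scale: "b (scale c x) z = c * b x z"
begin

definition char_sum :: "'v set \<Rightarrow> int" where
  "char_sum W = (\<Sum>x\<in>W. \<psi> (f x))"

text \<open>This is the radical of the polar form on \<open>W\<close>: on it \<open>f\<close> is
  additive but may take nonzero values.\<close>

definition radical :: "'v set \<Rightarrow> 'v set" where
  "radical W = {z \<in> W. \<forall>x\<in>W. b x z = 0}"

lemma b_commute: "b x y = b y x"
  using f_add[of x y] f_add[of y x] by (simp add: add.commute)

lemma b_add_right: "b z (x + y) = b z x + b z y"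
  by (metis b_add b_commute)

lemma b_scale_right: "b z (scale c x) = c * b z x"
  by (metis b_scale b_commute)

lemma f_0 [simp]: "f 0 = 0"
  using f_scale[of 0 0] by simp

lemma vec_add_self: "x + x = (0 :: 'v)"
proof -
  have "x + x = scale (1 + 1) x"
    by (simp only: scale_left_distrib scale_one)
  then show ?thesis
    by (simp only: add_self scale_zero_left)
qed

lemma b_self [simp]: "b x x = 0"
  using f_add[of x x] by (simp only: vec_add_self f_0 add_self add_0)

lemma subspace_radical: "subspace W \<Longrightarrow> subspace (radical W)"
  unfolding radical_def
  by (intro subspaceI)
    (use b_scale_right[of _ 0 0] in \<open>auto simp: subspace_0 subspace_add subspace_scale b_add_right b_scale_right\<close>)

lemma char_sum_le_card: "char_sum W \<le> int (card W)"
  using sum_mono[of W "\<lambda>x. \<psi> (f x)" "\<lambda>_. 1"] by (simp add: char_sum_def psi_le_1)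

text \<open>Substitute \<open>y = x + z\<close>: in characteristic two
  \<open>f x + f (x + z) = f z + b x z\<close>, and the sum over \<open>x\<close> is that of a
  linear map, which survives only for \<open>z\<close> in the radical.\<close>

lemma char_sum_square:
  assumes W: "subspace W"
  shows "(char_sum W)\<^sup>2 = int (card W) * char_sum (radical W)"
proof -
  have "(char_sum W)\<^sup>2 = (\<Sum>x\<in>W. \<Sum>y\<in>W. \<psi> (f x) * \<psi> (f y))"
    by (simp add: char_sum_def power2_eq_square sum_product)
  also have "\<dots> = (\<Sum>x\<in>W. \<Sum>z\<in>W. \<psi> (f z) * \<psi> (b x z))"
  proof (rule sum.cong[OF refl])
    fix x assume x: "x \<in> W"
    have "(\<Sum>y\<in>W. \<psi> (f x) * \<psi> (f y)) = (\<Sum>z\<in>W. \<psi> (f x) * \<psi> (f (x + z)))"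
      by (rule sum.reindex_bij_witness[of _ "\<lambda>z. x + z" "\<lambda>y. y - x"])
        (use x W in \<open>auto intro: subspace_add subspace_diff\<close>)
    also have "\<dots> = (\<Sum>z\<in>W. \<psi> (f z) * \<psi> (b x z))"
      unfolding psi_add[symmetric] by (simp only: f_add add.assoc add_self_left)
    finally show "(\<Sum>y\<in>W. \<psi> (f x) * \<psi> (f y)) = (\<Sum>z\<in>W. \<psi> (f z) * \<psi> (b x z))" .
  qed
  also have "\<dots> = (\<Sum>z\<in>W. \<psi> (f z) * (\<Sum>x\<in>W. \<psi> (b x z)))"
    by (subst sum.swap) (simp add: sum_distrib_left)
  also have "\<dots> = (\<Sum>z\<in>W. if z \<in> radical W then int (card W) * \<psi> (f z) else 0)"
  proof (rule sum.cong[OF refl])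
    fix z assume z: "z \<in> W"
    have "(\<Sum>x\<in>W. \<psi> (b x z)) = (if \<forall>x\<in>W. b x z = 0 then int (card W) else 0)"
      by (rule sum_psi_linear[OF vector_space_axioms W]) (simp_all add: b_add b_scale)
    with z show "\<psi> (f z) * (\<Sum>x\<in>W. \<psi> (b x z))
      = (if z \<in> radical W then int (card W) * \<psi> (f z) else 0)"
      by (simp add: radical_def)
  qed
  also have "\<dots> = (\<Sum>z\<in>W \<inter> radical W. int (card W) * \<psi> (f z))"
    by (simp add: sum.inter_restrict)
  also have "W \<inter> radical W = radical W"
    by (auto simp: radical_def)
  finally show ?thesis
    by (simp add: char_sum_def sum_distrib_left)
qed

text \<open>If \<open>b\<close> vanishes on \<open>W\<close>, the square identity leaves only the
  values 0 and \<open>card W\<close>. Otherwise the radical has codimension at least 2; the extra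
  bound \<open>CARD('k)\<^sup>2 \<le> card W\<close> excludes negative sums below dimension
  2.\<close>

lemma char_sum_ge:
  assumes W: "subspace W"
  shows "char_sum W \<ge> 0 \<or> int CARD('k) * char_sum W \<ge> - int (card W) \<and> CARD('k)\<^sup>2 \<le> card W"
proof (cases "radical W = W")
  case True
  have "char_sum W * char_sum W = int (card W) * char_sum W"
    using char_sum_square[OF W] True by (simp add: power2_eq_square)
  then have "char_sum W = int (card W) \<or> char_sum W = 0"
    by auto
  then show ?thesis
    by auto
next
  case False
  then obtain w x where w: "w \<in> W" "w \<notin> radical W" and x: "x \<in> W" "b x w \<noteq> 0"
    by (auto simp: radical_def)
  \<comment> \<open>Since \<open>b\<close> is alternating, \<open>w\<close> lies in
    \<open>K\<close>. The radical plus the line of \<open>w\<close> fits in \<open>K\<close>, and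
    \<open>K\<close> plus the line of \<open>x\<close> fits in \<open>W\<close>; this gives two
    factors \<open>CARD('k)\<close>.\<close>
  define K where "K = {z \<in> W. b z w = 0}"
  have RK: "CARD('k) * card (radical W) \<le> card K"
  proof -
    have "inj_on (\<lambda>(c, z). scale c w + z) (UNIV \<times> radical W)"
    proof (intro inj_onI, clarify)
      fix c z d y
      assume zy: "z \<in> radical W" "y \<in> radical W" and eq: "scale c w + z = scale d w + y"
      have "scale (c - d) w = y - z"
        using eq by (simp add: algebra_simps)
      then have "scale (c - d) w \<in> radical W"
        using zy subspace_radical[OF W] by (simp only: subspace_diff)
      then have "scale (inverse (c - d)) (scale (c - d) w) \<in> radical W"
        by (rule subspace_scale[OF subspace_radical[OF W]])
      then have "c = d"
        using w by (cases "c = d") simp_all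
      with eq show "c = d \<and> z = y"
        by simp
    qed
    then have "card (UNIV \<times> radical W :: ('k \<times> 'v) set)
      = card ((\<lambda>(c, z). scale c w + z) ` (UNIV \<times> radical W))"
      by (rule card_image[symmetric])
    also have "\<dots> \<le> card K"
    proof (rule card_mono)
      show "(\<lambda>(c, z). scale c w + z) ` (UNIV \<times> radical W) \<subseteq> K"
        using w W b_commute[of _ w]
        by (auto simp: K_def radical_def b_add_right b_scale_right subspace_add subspace_scale)
    qed simp
    finally show ?thesis
      by (simp add: card_cartesian_product)
  qed
  have KW: "CARD('k) * card K \<le> card W"
  proof -
    have "inj_on (\<lambda>(c, z). scale c x + z) (UNIV \<times> K)"
    proof (intro inj_onI, clarify)
      fix c z d y
      assume zy: "z \<in> K" "y \<in> K" and eq: "scale c x + z = scale d x + y"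
      have "b (scale c x + z) w = b (scale d x + y) w"
        using eq by simp
      then have "c = d"
        using zy x by (simp add: K_def b_add b_scale)
      with eq show "c = d \<and> z = y"
        by simp
    qed
    then have "card (UNIV \<times> K :: ('k \<times> 'v) set) = card ((\<lambda>(c, z). scale c x + z) ` (UNIV \<times> K))"
      by (rule card_image[symmetric])
    also have "\<dots> \<le> card W"
    proof (rule card_mono)
      show "(\<lambda>(c, z). scale c x + z) ` (UNIV \<times> K) \<subseteq> W"
        using x W by (auto simp: K_def subspace_add subspace_scale)
    qed simp
    finally show ?thesis
      by (simp add: card_cartesian_product)
  qed
  have R: "CARD('k)\<^sup>2 * card (radical W) \<le> card W"
    using order_trans[OF mult_le_mono2[OF RK] KW] by (simp only: power2_eq_square mult.assoc)
  have "(int CARD('k) * char_sum W)\<^sup>2 = int (card W) * ((int CARD('k))\<^sup>2 * char_sum (radical W))"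
    by (simp add: power_mult_distrib char_sum_square[OF W])
  also have "\<dots> \<le> int (card W) * ((int CARD('k))\<^sup>2 * int (card (radical W)))"
    by (intro mult_left_mono char_sum_le_card) simp_all
  also have "\<dots> \<le> int (card W) * int (card W)"
    using R by (intro mult_left_mono) (simp_all flip: of_nat_power of_nat_mult)
  finally have "\<bar>int CARD('k) * char_sum W\<bar> \<le> \<bar>int (card W)\<bar>"
    unfolding abs_le_square_iff by (simp only: power2_eq_square)
  moreover have "card (radical W) \<ge> 1"
    using subspace_0[OF subspace_radical[OF W]] by (auto simp: Suc_le_eq card_gt_0_iff)
  then have "CARD('k)\<^sup>2 \<le> card W"
    using R by (metis mult.commute mult_le_mono1 mult_1 le_trans)
  ultimately show ?thesis
    by linarith
qed

text \<open>Substituting \<open>x \<mapsto> \<surd>t x\<close> turns \<open>\<psi> (t * f x)\<close> into \<open>\<psi> (f x)\<close>, so all nontrivial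
  additive characters give the same sum.\<close>

lemma card_eq_char_sum:
  assumes W: "subspace W" and a: "a \<noteq> 0"
  shows "int (card W) = char_sum W + int CARD('k) * int (card {x \<in> W. f x = a})"
proof -
  have twist: "(\<Sum>x\<in>W. \<psi> (t * f x)) = (if t = 0 then int (card W) else char_sum W)" for t
  proof (cases "t = 0")
    case False
    obtain s where s: "s\<^sup>2 = t"
      using ex_sqrt by blast
    have "s \<noteq> 0"
      using s False by auto
    have "(\<Sum>x\<in>W. \<psi> (f (scale s x))) = (\<Sum>x\<in>W. \<psi> (f x))"
      by (rule sum.reindex_bij_witness[of _ "scale (inverse s)" "scale s"])
        (use W \<open>s \<noteq> 0\<close> in \<open>auto intro: subspace_scale\<close>)
    then show ?thesis
      using False by (simp add: f_scale s char_sum_def)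
  qed simp
  have "int CARD('k) * int (card {x \<in> W. f x = a})
    = (\<Sum>x\<in>W. if f x = a then int CARD('k) else 0)"
    by (simp add: sum.If_cases Int_def mult.commute)
  \<comment> \<open>Summing \<open>\<psi> (t * u)\<close> over \<open>t\<close> detects
    \<open>u = 0\<close>, and \<open>f x = a\<close> means \<open>f x + a = 0\<close>.\<close>
  also have "\<dots> = (\<Sum>x\<in>W. \<Sum>t\<in>UNIV. \<psi> (t * (f x + a)))"
  proof (rule sum.cong[OF refl])
    fix x
    have "f x + a = 0 \<longleftrightarrow> f x = a"
      using add_self by (metis add_right_cancel)
    then show "(if f x = a then int CARD('k) else 0) = (\<Sum>t\<in>UNIV. \<psi> (t * (f x + a)))"
      by (simp only: sum_psi_mult)
  qed
  also have "\<dots> = (\<Sum>t\<in>UNIV. \<psi> (t * a) * (\<Sum>x\<in>W. \<psi> (t * f x)))"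
    by (subst sum.swap) (simp add: distrib_left psi_add sum_distrib_left mult.commute)
  \<comment> \<open>The term for \<open>t = 0\<close> is corrected separately, so that the rest is a
    full sum of \<open>\<psi> (t * a)\<close>, which vanishes because
    \<open>a \<noteq> 0\<close>.\<close>
  also have "\<dots> = (\<Sum>t\<in>UNIV. \<psi> (t * a) * char_sum W
      + (if t = 0 then int (card W) - char_sum W else 0))"
    by (intro sum.cong refl) (simp add: twist)
  also have "\<dots> = (\<Sum>t\<in>UNIV. \<psi> (t * a)) * char_sum W + (int (card W) - char_sum W)"
    by (simp add: sum.distrib sum_distrib_right)
  finally show ?thesis
    using a by (simp add: sum_psi_mult)
qed

text \<open>The radical lies in the orthogonal complement of \<open>W\<close>, so
  \<open>card W * card (radical W)\<close> is at most \<open>CARD('v)\<close>.\<close>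

lemma char_sum_square_le:
  assumes W: "subspace W" and nondeg: "\<And>z. \<forall>x. b x z = 0 \<Longrightarrow> z = 0"
  shows "(char_sum W)\<^sup>2 \<le> int CARD('v)"
proof -
  have "card (radical W) \<le> card {x. \<forall>u\<in>W. b x u = 0}"
    by (rule card_mono) (auto simp: radical_def b_commute)
  then have "card W * card (radical W) \<le> card W * card {x. \<forall>u\<in>W. b x u = 0}"
    by (rule mult_le_mono2)
  also have "\<dots> = CARD('v)"
    by (rule card_orthogonal[OF vector_space_axioms W b_add b_scale b_add_right b_scale_right nondeg])
  finally have "int (card W) * int (card (radical W)) \<le> int CARD('v)"
    by (simp flip: of_nat_mult)
  moreover have "(char_sum W)\<^sup>2 \<le> int (card W) * int (card (radical W))"
    unfolding char_sum_square[OF W] by (intro mult_left_mono char_sum_le_card) simp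
  ultimately show ?thesis
    by linarith
qed

end

section \<open>Elliptic forms in coordinates\<close>

text \<open>\<open>P x i\<close> is the \<open>i\<close>-th pair of coordinates \<open>(x\<^bsub>2i-1\<^esub>, x\<^bsub>2i\<^esub>)\<close>.\<close>

definition max_points :: "nat \<Rightarrow> nat \<Rightarrow> nat \<Rightarrow> nat" where
  "max_points q h k =
    (if h < k then q ^ (k - 1) + q ^ (h - 1)
     else if 2 \<le> k then q ^ (k - 1) + q ^ (k - 2) else k)"

text \<open>\<open>max_points q h k\<close> will be the largest number of points with a given
  nonzero value of the form in a \<open>k\<close>-dimensional subspace; the strict inequality keeps
  such a level set out of every hyperplane. For \<open>h = 1\<close> the hyperplane falls under the
  last branch.\<close>

lemma max_points_hyperplane_less:
  assumes "2 \<le> q" "0 < h"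
  shows "max_points q h (2 * h - 1) < max_points q h (2 * h)"
proof (cases "h = 1")
  case True
  then show ?thesis
    using assms by (simp add: max_points_def)
next
  case False
  have "q ^ (2 * h - 1 - 1) < q ^ (2 * h - 1)"
    using assms by (intro power_strict_increasing) simp_all
  then show ?thesis
    using assms False by (simp add: max_points_def)
qed

lemma sum_UNIV_pair:
  fixes g :: "'a::finite \<Rightarrow> 'b::finite \<Rightarrow> 'c::comm_monoid_add"
  shows "(\<Sum>p\<in>UNIV. g (fst p) (snd p)) = (\<Sum>v\<in>UNIV. \<Sum>u\<in>UNIV. g u v)"
  by (subst sum.swap) (simp add: sum.cartesian_product case_prod_beta)

text \<open>\<open>P x i\<close> is meaningful only for \<open>i\<close> in \<open>{1..h}\<close>,
  hence \<open>restrict\<close> in \<open>P_bij\<close>, which turns sums over the space into sums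
  over a product. Through \<open>psi_alpha\<close> enters that \<open>\<alpha>\<close> is no value
  of x^2 + x.\<close>

locale elliptic_space = vector_space scale + binary_character \<psi>
  for scale :: "'k::{field,finite} \<Rightarrow> 'v::{ab_group_add,finite} \<Rightarrow> 'v"
    and \<psi> :: "'k \<Rightarrow> int" +
  fixes P :: "'v \<Rightarrow> nat \<Rightarrow> 'k \<times> 'k" and h :: nat and \<alpha> :: 'k
  assumes h_pos: "0 < h"
    and psi_alpha: "\<psi> \<alpha> = - 1"
    and P_bij: "bij_betw (\<lambda>x. restrict (P x) {1..h}) UNIV ({1..h} \<rightarrow>\<^sub>E UNIV)"
    and P_add: "i \<in> {1..h} \<Longrightarrow> P (x + y) i = (fst (P x i) + fst (P y i), snd (P x i) + snd (P y i))"
    and P_scale: "i \<in> {1..h} \<Longrightarrow> P (scale c x) i = (c * fst (P x i), c * snd (P x i))"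
begin

definition pair_form :: "nat \<Rightarrow> 'k \<times> 'k \<Rightarrow> 'k" where
  "pair_form i p = (if i = h then \<alpha> * (fst p)\<^sup>2 + fst p * snd p + \<alpha> * (snd p)\<^sup>2 else fst p * snd p)"

definition form :: "'v \<Rightarrow> 'k" where
  "form x = (\<Sum>i=1..h. pair_form i (P x i))"

text \<open>The squares in the last pair are additive in characteristic two, so that pair
  contributes to the polar form like all the others.\<close>

definition polar :: "'v \<Rightarrow> 'v \<Rightarrow> 'k" where
  "polar x y = (\<Sum>i=1..h. fst (P x i) * snd (P y i) + snd (P x i) * fst (P y i))"

sublocale quadratic_space scale \<psi> form polar
proof
  fix x y z :: 'v and c :: 'k
  show "form (x + y) = form x + form y + polar x y"
    unfolding form_def polar_def sum.distrib[symmetric]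
    by (intro sum.cong refl)
      (simp add: P_add pair_form_def square_add distrib_left distrib_right ac_simps)
  show "form (scale c x) = c\<^sup>2 * form x"
    unfolding form_def sum_distrib_left
    by (intro sum.cong refl)
      (simp add: P_scale pair_form_def distrib_left power2_eq_square ac_simps)
  show "polar (x + y) z = polar x z + polar y z"
    unfolding polar_def sum.distrib[symmetric]
    by (intro sum.cong refl) (simp add: P_add distrib_left distrib_right ac_simps)
  show "polar (scale c x) z = c * polar x z"
    unfolding polar_def sum_distrib_left
    by (intro sum.cong refl) (simp add: P_scale distrib_left ac_simps)
qed

lemma P_eqI: "(\<And>i. i \<in> {1..h} \<Longrightarrow> P x i = P y i) \<Longrightarrow> x = y"
  by (rule injD[OF bij_betw_imp_inj_on[OF P_bij]]) (rule restrict_ext)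

lemma ex_P: "\<exists>x. \<forall>i\<in>{1..h}. P x i = g i"
proof -
  have "restrict g {1..h} \<in> (\<lambda>x. restrict (P x) {1..h}) ` UNIV"
    using bij_betw_imp_surj_on[OF P_bij] by simp
  then obtain x where x: "restrict (P x) {1..h} = restrict g {1..h}"
    by auto
  have "P x i = g i" if "i \<in> {1..h}" for i
    using fun_cong[OF x, of i] that by simp
  then show ?thesis
    by blast
qed

lemma P_0: "i \<in> {1..h} \<Longrightarrow> P 0 i = (0, 0)"
  using P_scale[of i 0 0] by simp

lemma polar_nondegenerate:
  assumes "\<forall>x. polar x z = 0"
  shows "z = 0"
proof (rule P_eqI)
  fix i assume i: "i \<in> {1..h}"
  \<comment> \<open>Test \<open>z\<close> against vectors supported on the pair \<open>i\<close>
    alone.\<close>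
  have *: "fst p * snd (P z i) + snd p * fst (P z i) = 0" for p
  proof -
    obtain x where x: "\<forall>j\<in>{1..h}. P x j = (if j = i then p else (0, 0))"
      using ex_P[of "\<lambda>j. if j = i then p else (0, 0)"] by blast
    have "polar x z = (\<Sum>j=1..h. if j = i then fst p * snd (P z i) + snd p * fst (P z i) else 0)"
      unfolding polar_def by (intro sum.cong refl) (simp add: x)
    also have "\<dots> = fst p * snd (P z i) + snd p * fst (P z i)"
      using i by simp
    finally show ?thesis
      using assms by simp
  qed
  show "P z i = P 0 i"
    using *[of "(1, 0)"] *[of "(0, 1)"] P_0[OF i] by (simp add: prod_eq_iff)
qed

text \<open>Sets that split along the pairs: their cardinalities and character sums factor into one
  term per pair.\<close>

definition block :: "(nat \<Rightarrow> ('k \<times> 'k) set) \<Rightarrow> 'v set" where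
  "block B = {x. \<forall>i\<in>{1..h}. P x i \<in> B i}"

lemma subspace_block:
  assumes "\<And>i. (0, 0) \<in> B i"
    and "\<And>i u v u' v'. (u, v) \<in> B i \<Longrightarrow> (u', v') \<in> B i \<Longrightarrow> (u + u', v + v') \<in> B i"
    and "\<And>i c u v. (u, v) \<in> B i \<Longrightarrow> (c * u, c * v) \<in> B i"
  shows "subspace (block B)"
  unfolding block_def by (intro subspaceI) (simp_all add: P_0 P_add P_scale assms)

lemma block_bij: "bij_betw (\<lambda>x. restrict (P x) {1..h}) (block B) (Pi\<^sub>E {1..h} B)"
  unfolding bij_betw_def
proof
  show "inj_on (\<lambda>x. restrict (P x) {1..h}) (block B)"
    using bij_betw_imp_inj_on[OF P_bij] inj_on_subset by blast
  show "(\<lambda>x. restrict (P x) {1..h}) ` block B = Pi\<^sub>E {1..h} B"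
  proof (intro equalityI subsetI)
    fix g assume g: "g \<in> Pi\<^sub>E {1..h} B"
    obtain x where x: "\<forall>i\<in>{1..h}. P x i = g i"
      using ex_P by blast
    have "restrict (P x) {1..h} = g"
      using x g by (auto simp: restrict_def PiE_def extensional_def)
    moreover have "x \<in> block B"
      using x g by (auto simp: block_def)
    ultimately show "g \<in> (\<lambda>x. restrict (P x) {1..h}) ` block B"
      by blast
  qed (auto simp: block_def)
qed

lemma card_block: "card (block B) = (\<Prod>i=1..h. card (B i))"
  using bij_betw_same_card[OF block_bij[of B]] by (simp add: card_PiE)

lemma char_sum_block: "char_sum (block B) = (\<Prod>i=1..h. \<Sum>p\<in>B i. \<psi> (pair_form i p))"
proof -
  have "char_sum (block B)
    = (\<Sum>x\<in>block B. (\<lambda>g. \<Prod>i=1..h. \<psi> (pair_form i (g i))) (restrict (P x) {1..h}))"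
    unfolding char_sum_def form_def psi_sum by (intro sum.cong prod.cong refl) simp
  also have "\<dots> = (\<Sum>g\<in>Pi\<^sub>E {1..h} B. \<Prod>i=1..h. \<psi> (pair_form i (g i)))"
    by (rule sum.reindex_bij_betw[OF block_bij])
  also have "\<dots> = (\<Prod>i=1..h. \<Sum>p\<in>B i. \<psi> (pair_form i p))"
    by (rule prod_sum_PiE[symmetric]) simp_all
  finally show ?thesis .
qed

lemma sum_psi_hyperbolic: "(\<Sum>p\<in>UNIV. \<psi> (fst p * snd p)) = int CARD('k)"
  by (simp add: sum_UNIV_pair[of "\<lambda>u v. \<psi> (u * v)"] sum_psi_mult)

text \<open>As \<open>\<psi>\<close> is invariant under squaring, \<open>\<psi> (\<alpha> u\<^sup>2) = \<psi> (\<beta> u)\<close> for \<open>\<beta>\<^sup>2 = \<alpha>\<close>, which makes the sum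
  over \<open>u\<close> a linear one.\<close>

lemma sum_psi_elliptic:
  "(\<Sum>p\<in>UNIV. \<psi> (\<alpha> * (fst p)\<^sup>2 + fst p * snd p + \<alpha> * (snd p)\<^sup>2)) = - int CARD('k)"
proof -
  obtain \<beta> where \<beta>: "\<beta>\<^sup>2 = \<alpha>"
    using ex_sqrt by blast
  have sq: "\<psi> (\<alpha> * u\<^sup>2) = \<psi> (u * \<beta>)" for u
    using psi_square[of "u * \<beta>"] \<beta> by (simp add: power_mult_distrib mult.commute)
  have "(\<Sum>p\<in>UNIV. \<psi> (\<alpha> * (fst p)\<^sup>2 + fst p * snd p + \<alpha> * (snd p)\<^sup>2))
    = (\<Sum>v\<in>UNIV. \<Sum>u\<in>UNIV. \<psi> (u * (\<beta> + v)) * \<psi> (\<alpha> * v\<^sup>2))"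
    unfolding sum_UNIV_pair[of "\<lambda>u v. \<psi> (\<alpha> * u\<^sup>2 + u * v + \<alpha> * v\<^sup>2)"]
    by (simp add: psi_add sq distrib_left)
  also have "\<dots> = (\<Sum>v\<in>UNIV. if \<beta> + v = 0 then int CARD('k) * \<psi> (\<alpha> * v\<^sup>2) else 0)"
    by (intro sum.cong refl) (simp add: sum_distrib_right[symmetric] sum_psi_mult)
  also have "\<dots> = (\<Sum>v\<in>UNIV. if v = \<beta> then int CARD('k) * \<psi> (\<alpha> * v\<^sup>2) else 0)"
  proof (intro sum.cong refl if_cong)
    fix v
    show "\<beta> + v = 0 \<longleftrightarrow> v = \<beta>"
      using add_self by (metis add_left_cancel)
  qed
  also have "\<dots> = int CARD('k) * \<psi> (\<alpha> * \<beta>\<^sup>2)"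
    by simp
  \<comment> \<open>By \<open>psi_square\<close> the remaining value is
    \<open>\<psi> \<alpha> = - 1\<close>, the source of the negative sign.\<close>
  also have "\<alpha> * \<beta>\<^sup>2 = \<alpha>\<^sup>2"
    by (simp only: \<beta>) (simp only: power2_eq_square)
  finally show ?thesis
    by (simp add: psi_square psi_alpha)
qed

text \<open>Of the first \<open>h - 1\<close> hyperbolic pairs, \<open>j\<close> are cut down to a line and the others are kept
  (\<open>full\<close>) or dropped; the anisotropic pair is kept.\<close>

definition flag_block :: "bool \<Rightarrow> nat \<Rightarrow> 'v set" where
  "flag_block full j =
    block (\<lambda>i. if i = h then UNIV else if i \<le> j then UNIV \<times> {0} else if full then UNIV else {(0, 0)})"

lemma subspace_flag_block: "subspace (flag_block full j)"
  unfolding flag_block_def by (rule subspace_block) (auto split: if_splits)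

lemma prod_flag:
  assumes "j < h"
  shows "(\<Prod>i=1..h. if i = h then c else if i \<le> j then d else e) = c * d ^ j * (e :: 'c::comm_monoid_mult) ^ (h - 1 - j)"
proof -
  let ?g = "\<lambda>i. if i = h then c else if i \<le> j then d else e"
  have "{1..h} = insert h ({1..j} \<union> {j+1..h-1})"
    using assms h_pos by auto
  moreover have "h \<notin> {1..j} \<union> {j+1..h-1}"
    using assms by auto
  moreover have "prod ?g ({1..j} \<union> {j+1..h-1}) = prod ?g {1..j} * prod ?g {j+1..h-1}"
    by (rule prod.union_disjoint) auto
  moreover have "prod ?g {1..j} = (\<Prod>i\<in>{1..j}. d)"
    using assms by (intro prod.cong) auto
  moreover have "prod ?g {j+1..h-1} = (\<Prod>i\<in>{j+1..h-1}. e)"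
    using assms by (intro prod.cong) auto
  ultimately show ?thesis
    by (simp add: mult.assoc)
qed

lemma card_flag_block:
  assumes "j < h"
  shows "card (flag_block full j) = CARD('k) ^ (2 + j + (if full then 2 * (h - 1 - j) else 0))"
proof -
  have "card (flag_block full j)
    = (\<Prod>i=1..h. if i = h then CARD('k) * CARD('k) else if i \<le> j then CARD('k)
        else if full then CARD('k) * CARD('k) else 1)"
    unfolding flag_block_def card_block
    by (intro prod.cong refl) (simp add: card_cartesian_product)
  also have "\<dots> = CARD('k) * CARD('k) * CARD('k) ^ j
      * (if full then CARD('k) * CARD('k) else 1) ^ (h - 1 - j)"
    by (rule prod_flag[OF assms])
  finally show ?thesis
    by (simp add: power_add power_mult power2_eq_square)
qed

text \<open>The product form vanishes on a line, which thus contributes \<open>CARD('k)\<close>, as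
  does a full hyperbolic plane. A dropped pair contributes 1 and the anisotropic plane
  \<open>- CARD('k)\<close>, so with \<open>full\<close> the value does not depend on
  \<open>j\<close>.\<close>

lemma char_sum_flag_block:
  assumes "j < h"
  shows "char_sum (flag_block full j) = - (int CARD('k) ^ (1 + (if full then h - 1 else j)))"
proof -
  have "(\<Sum>p\<in>(UNIV :: 'k set) \<times> {0 :: 'k}. \<psi> (fst p * snd p)) = (\<Sum>p\<in>(UNIV :: 'k set) \<times> {0 :: 'k}. 1)"
    by (rule sum.cong) auto
  also have "\<dots> = int CARD('k)"
    by (simp add: card_cartesian_product)
  finally have "char_sum (flag_block full j)
    = (\<Prod>i=1..h. if i = h then - int CARD('k) else if i \<le> j then int CARD('k)
        else if full then int CARD('k) else 1)"
    unfolding flag_block_def char_sum_block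
    by (intro prod.cong refl) (simp add: pair_form_def sum_psi_elliptic sum_psi_hyperbolic)
  also have "\<dots> = - int CARD('k) * int CARD('k) ^ j * (if full then int CARD('k) else 1) ^ (h - 1 - j)"
    by (rule prod_flag[OF assms])
  finally show ?thesis
    using assms by (simp flip: power_add)
qed

lemma CARD_space: "CARD('v) = CARD('k) ^ (2 * h)"
  using card_block[of "\<lambda>_. UNIV"] by (simp add: block_def power_mult power2_eq_square)

text \<open>By \<open>card_eq_char_sum\<close> an upper bound on the count is a lower bound on
  \<open>char_sum W\<close>. The bound from nondegeneracy serves \<open>h < k\<close>, the one from
  the codimension of the radical \<open>2 \<le> k \<le> h\<close>.\<close>

lemma card_level_le_max_points:
  assumes W: "subspace W" "card W = CARD('k) ^ k" and a: "a \<noteq> 0"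
  shows "card {x \<in> W. form x = a} \<le> max_points CARD('k) h k"
proof -
  let ?q = "int CARD('k)" and ?N = "int (card {x \<in> W. form x = a})"
  have q: "?q \<ge> 2"
    using CARD_ge_2[where ?'a = 'k] by simp
  have N: "?q * ?N = ?q ^ k - char_sum W"
    using card_eq_char_sum[OF W(1) a] W(2) by simp
  consider "h < k" | "k \<le> h" "2 \<le> k" | "k = 1" "\<not> h < k" | "k = 0"
    by linarith
  then show ?thesis
  proof cases
    case 1
    have "(char_sum W)\<^sup>2 \<le> (?q ^ h)\<^sup>2"
      using char_sum_square_le[OF W(1) polar_nondegenerate]
      by (simp add: CARD_space power_mult mult.commute[of 2])
    then have "- char_sum W \<le> ?q ^ h"
      using q by (simp add: abs_le_square_iff[symmetric])
    then have "?q * ?N \<le> ?q ^ Suc (k - 1) + ?q ^ Suc (h - 1)"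
      using N 1 h_pos by simp
    then have "?q * ?N \<le> ?q * (?q ^ (k - 1) + ?q ^ (h - 1))"
      by (simp add: distrib_left)
    then have "?N \<le> ?q ^ (k - 1) + ?q ^ (h - 1)"
      using q by simp
    then show ?thesis
      using 1 by (simp add: max_points_def flip: of_nat_power of_nat_add)
  next
    case 2
    have "?q * char_sum W \<ge> - (?q ^ k)"
      using char_sum_ge[OF W(1)] q W(2)
      by (auto intro: order_trans[of _ 0])
    then have "?q * (?q * ?N) \<le> ?q * ?q ^ k + ?q ^ k"
      unfolding N by (simp add: right_diff_distrib)
    also have "\<dots> = ?q * (?q * (?q ^ (k - 1) + ?q ^ (k - 2)))"
    proof -
      obtain l where "k = Suc (Suc l)"
        using 2 by (intro that[of "k - 2"]) simp
      then show ?thesis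
        by (simp add: distrib_left)
    qed
    finally have "?N \<le> ?q ^ (k - 1) + ?q ^ (k - 2)"
      using q by simp
    then show ?thesis
      using 2 by (simp add: max_points_def flip: of_nat_power of_nat_add)
  next
    case 3
    \<comment> \<open>On a line the negative alternative would require
      \<open>CARD('k)\<^sup>2 \<le> CARD('k)\<close>.\<close>
    have "\<not> CARD('k)\<^sup>2 \<le> card W"
      using q W(2) 3 by (simp add: power2_eq_square)
    then have "char_sum W \<ge> 0"
      using char_sum_ge[OF W(1)] by blast
    then have "?q * ?N \<le> ?q * 1"
      using N 3 by simp
    then have "?N \<le> 1"
      using q by (simp only: mult_le_cancel_left)
    then show ?thesis
      using 3 by (simp add: max_points_def)
  next
    case 4
    then obtain w where "W = {w}"
      using W(2) by (auto simp: card_1_singleton_iff)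
    then have "W = {0}"
      using subspace_0[OF W(1)] by simp
    then have "{x \<in> W. form x = a} = {}"
      using a by auto
    then show ?thesis
      by (simp only: card.empty le0)
  qed
qed

lemma ex_card_level_eq_max_points:
  assumes k: "k \<le> 2 * h" and a: "a \<noteq> 0"
  shows "\<exists>W. subspace W \<and> card W = CARD('k) ^ k \<and> card {x \<in> W. form x = a} = max_points CARD('k) h k"
proof -
  let ?q = "int CARD('k)"
  have q: "?q \<ge> 2"
    using CARD_ge_2[where ?'a = 'k] by simp
  \<comment> \<open>This is stated for every such \<open>k\<close>, since the case of a line also
    calls on it, for the whole space.\<close>
  have big: "\<exists>W. subspace W \<and> card W = CARD('k) ^ k \<and> card {x \<in> W. form x = a} = max_points CARD('k) h k"
    if "h < k" "k \<le> 2 * h" for k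
  proof -
    \<comment> \<open>Each line in place of a plane lowers the dimension by one, so
      \<open>2 * h - k\<close> lines leave dimension \<open>k\<close>, while the sum stays
      \<open>- (?q ^ h)\<close>.\<close>
    let ?W = "flag_block True (2 * h - k)"
    have j: "2 * h - k < h"
      using that by simp
    have card: "card ?W = CARD('k) ^ k"
    proof -
      have "2 + (2 * h - k) + 2 * (h - 1 - (2 * h - k)) = k"
        using that by simp
      then show ?thesis
        unfolding card_flag_block[OF j] by simp
    qed
    have "?q * int (card {x \<in> ?W. form x = a}) = ?q ^ Suc (k - 1) + ?q ^ Suc (h - 1)"
      using card_eq_char_sum[OF subspace_flag_block a, of True "2 * h - k"] card
        char_sum_flag_block[OF j, of True] that by simp
    then have "?q * int (card {x \<in> ?W. form x = a}) = ?q * int (max_points CARD('k) h k)"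
      unfolding power_Suc distrib_left[symmetric] using that by (simp only: max_points_def if_True) simp
    then have "card {x \<in> ?W. form x = a} = max_points CARD('k) h k"
      by simp
    with card show ?thesis
      using subspace_flag_block by blast
  qed
  consider "h < k" | "k \<le> h" "2 \<le> k" | "k = 1" "\<not> h < k" | "k = 0"
    by linarith
  then show ?thesis
  proof cases
    case 1
    then show ?thesis
      using big k by blast
  next
    case 2
    obtain l where l: "k = Suc (Suc l)"
      using 2 by (intro that[of "k - 2"]) simp
    \<comment> \<open>A totally singular subspace of dimension \<open>k - 2\<close> plus the
      anisotropic plane; its sum is \<open>- (?q ^ (k - 1))\<close>.\<close>
    let ?W = "flag_block False l"
    have j: "l < h"
      using 2 l by simp
    have card: "card ?W = CARD('k) ^ k"
      unfolding card_flag_block[OF j] using l by simp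
    have "?q * int (card {x \<in> ?W. form x = a}) = ?q * int (max_points CARD('k) h k)"
      using card_eq_char_sum[OF subspace_flag_block a, of False l] card
        char_sum_flag_block[OF j, of False] 2 l by (simp add: max_points_def distrib_left)
    then have "card {x \<in> ?W. form x = a} = max_points CARD('k) h k"
      by simp
    with card show ?thesis
      using subspace_flag_block by blast
  next
    case 3
    \<comment> \<open>A line is extremal as soon as it meets the level set; the count in dimension
      \<open>2 * h\<close> provides such a point.\<close>
    obtain V where "card {x \<in> V. form x = a} = max_points CARD('k) h (2 * h)"
      using big[of "2 * h"] h_pos by auto
    moreover have "max_points CARD('k) h (2 * h) > 0"
      using h_pos by (simp add: max_points_def)
    ultimately have "{x \<in> V. form x = a} \<noteq> {}"
      by (metis card.empty less_irrefl)
    then obtain d where d: "form d = a"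
      by blast
    have "d \<noteq> 0"
      using d a by auto
    let ?W = "range (\<lambda>c. scale c d)"
    have W: "subspace ?W"
      by (intro subspaceI)
        (auto simp flip: scale_left_distrib intro: range_eqI[of _ _ 0])
    have "inj (\<lambda>c. scale c d)"
      using \<open>d \<noteq> 0\<close> by (simp add: inj_def)
    then have card: "card ?W = CARD('k) ^ k"
      using 3 by (simp add: card_image)
    have "d \<in> {x \<in> ?W. form x = a}"
      using d by (auto intro: range_eqI[of _ _ 1])
    then have "card {x \<in> ?W. form x = a} \<ge> 1"
      by (metis One_nat_def Suc_leI card_gt_0_iff empty_iff finite)
    moreover have "max_points CARD('k) h k = 1"
      using 3 by (simp add: max_points_def)
    ultimately have "card {x \<in> ?W. form x = a} = max_points CARD('k) h k"
      using card_level_le_max_points[OF W card a] by simp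
    then show ?thesis
      using W card by blast
  next
    case 4
    have "{x \<in> {0}. form x = a} = {}"
      using a by auto
    then have "card {x \<in> {0}. form x = a} = max_points CARD('k) h k"
      using 4 by (simp add: max_points_def)
    then show ?thesis
      using 4 subspace_single_0 by (intro exI[of _ "{0}"]) simp
  qed
qed

lemma card_level: "a \<noteq> 0 \<Longrightarrow> card {x. form x = a} = max_points CARD('k) h (2 * h)"
proof -
  assume "a \<noteq> 0"
  then obtain W where W: "card W = CARD('k) ^ (2 * h)"
      "card {x \<in> W. form x = a} = max_points CARD('k) h (2 * h)"
    using ex_card_level_eq_max_points[OF order_refl] by blast
  have "card W = CARD('v)"
    by (simp only: W CARD_space)
  then have "W = UNIV"
    by (rule card_eq_UNIV_imp_eq_UNIV[rotated]) simp
  then show ?thesis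
    using W(2) by simp
qed

end

section \<open>Trace codes\<close>

locale char2_field_extension =
  fixes emb :: "'k::{field,finite} \<Rightarrow> 'l::{field,finite}" and s m :: nat
  assumes emb: "field_embedding emb"
    and CARD_k: "CARD('k) = 2 ^ s"
    and CARD_l: "CARD('l) = CARD('k) ^ m"
    and m_pos: "0 < m"
begin

sublocale vector_space "ext_scale emb"
  by (rule vector_space_ext_scale[OF emb])

sublocale words: vector_space "fun_scale :: 'k \<Rightarrow> ('l \<Rightarrow> 'k) \<Rightarrow> _"
  by (rule vector_space_fun_scale)

lemma emb_simps [simp]:
  "emb 1 = 1" "emb (x + y) = emb x + emb y" "emb (x * y) = emb x * emb y"
  using emb by (simp_all add: field_embedding_def)

lemma emb_0 [simp]: "emb 0 = 0"
  using emb_simps(2)[of 0 0] unfolding add_0 by (simp only: add_cancel_right_left)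

lemma emb_power: "emb (x ^ n) = emb x ^ n"
  by (induction n) simp_all

lemma inj_emb: "inj emb"
proof (rule injI)
  fix x y assume eq: "emb x = emb y"
  have "emb x = emb (x - y) + emb y"
    by (simp flip: emb_simps(2))
  then have "emb (x - y) = 0"
    using eq by simp
  then have "emb ((x - y) * inverse (x - y)) = 0"
    by simp
  then show "x = y"
    by (cases "x = y") (simp_all del: emb_simps(3))
qed

lemma two_l: "(2 :: 'l) = 0"
  by (rule two_eq_0_if_CARD_power2[of "s * m"]) (simp add: CARD_l CARD_k power_mult)

text \<open>The trace inside \<open>'l\<close>. The inverse image taken in \<open>ext_trace\<close>
  can be used once this sum is known to lie in the range of \<open>emb\<close>.\<close>

definition conj_sum :: "'l \<Rightarrow> 'l" where
  "conj_sum x = (\<Sum>i<m. x ^ (CARD('k) ^ i))"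

lemma power_card_add: "(x + y :: 'l) ^ (CARD('k) ^ i) = x ^ (CARD('k) ^ i) + y ^ (CARD('k) ^ i)"
  using power2_add_char2[OF two_l, of x y "s * i"] by (simp add: CARD_k power_mult)

lemma conj_sum_add: "conj_sum (x + y) = conj_sum x + conj_sum y"
  by (simp add: conj_sum_def power_card_add sum.distrib)

lemma emb_power_card: "emb c ^ (CARD('k) ^ i) = emb c"
proof (induction i)
  case (Suc i)
  have "emb c ^ (CARD('k) ^ Suc i) = (emb c ^ CARD('k) ^ i) ^ CARD('k)"
    by (simp add: power_mult[symmetric] mult.commute)
  also have "\<dots> = emb (c ^ CARD('k))"
    by (simp only: Suc emb_power)
  finally show ?case
    by (simp only: finite_field_power_CARD)
qed simp

lemma conj_sum_scale: "conj_sum (emb c * x) = emb c * conj_sum x"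
  by (simp add: conj_sum_def power_mult_distrib emb_power_card sum_distrib_left)

text \<open>The range has \<open>CARD('k)\<close> elements, all of them roots of X^q - X with q =
  \<open>CARD('k)\<close>, which has no more roots than that.\<close>

lemma range_emb: "range emb = {y. y ^ CARD('k) = y}"
proof (rule card_seteq)
  show "range emb \<subseteq> {y :: 'l. y ^ CARD('k) = y}"
    using emb_power_card[of _ 1] by auto
  let ?p = "monom 1 CARD('k) - monom 1 1 :: 'l poly"
  have coeff: "coeff ?p CARD('k) = 1"
    using CARD_ge_2[where ?'a = 'k] by simp
  then have "?p \<noteq> 0"
    by (metis coeff_0 zero_neq_one)
  then have "card {y. poly ?p y = 0} \<le> degree ?p"
    by (rule card_poly_roots_bound)
  also have "degree ?p \<le> CARD('k)"
    using CARD_ge_2[where ?'a = 'k] by (intro degree_diff_le) (simp_all add: degree_monom_eq)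
  finally show "card {y :: 'l. y ^ CARD('k) = y} \<le> card (range emb)"
    by (simp add: poly_monom card_image[OF inj_emb])
qed simp

text \<open>Raising to the power \<open>CARD('k)\<close> shifts the conjugates cyclically, because
  \<open>x ^ (CARD('k) ^ m) = x\<close>.\<close>

lemma conj_sum_in_range: "conj_sum x \<in> range emb"
proof -
  have "(\<Sum>i\<in>A. g i) ^ CARD('k) = (\<Sum>i\<in>A. g i ^ CARD('k))" for A and g :: "nat \<Rightarrow> 'l"
    by (induction A rule: infinite_finite_induct)
      (use CARD_ge_2[where ?'a = 'k] power_card_add[of _ _ 1] in \<open>auto simp: power_0_left\<close>)
  then have "conj_sum x ^ CARD('k) = (\<Sum>i<m. x ^ (CARD('k) ^ Suc i))"
    by (simp add: conj_sum_def power_mult[symmetric] mult.commute)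
  also have "\<dots> = conj_sum x"
  proof -
    have "x ^ (CARD('k) ^ m) = x ^ (CARD('k) ^ 0)"
      using finite_field_power_CARD[of x] by (simp add: CARD_l)
    then show ?thesis
      using sum.lessThan_Suc_shift[of "\<lambda>i. x ^ (CARD('k) ^ i)" m]
        sum.lessThan_Suc[of "\<lambda>i. x ^ (CARD('k) ^ i)" m]
      by (simp add: conj_sum_def del: sum.lessThan_Suc power_Suc)
  qed
  finally show ?thesis
    by (simp add: range_emb)
qed

abbreviation Tr :: "'l \<Rightarrow> 'k" where
  "Tr \<equiv> ext_trace emb m"

lemma emb_Tr: "emb (Tr x) = conj_sum x"
  using f_the_inv_into_f[OF inj_emb conj_sum_in_range[of x]]
  by (simp add: ext_trace_def conj_sum_def)

lemma Tr_add: "Tr (x + y) = Tr x + Tr y"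
  by (rule injD[OF inj_emb]) (simp add: emb_Tr conj_sum_add)

lemma Tr_scale: "Tr (emb c * x) = c * Tr x"
  by (rule injD[OF inj_emb]) (simp add: emb_Tr conj_sum_scale)

text \<open>Otherwise the trace polynomial, nonzero because its coefficient in degree 1 is 1, would
  have all of \<open>'l\<close> as roots although its degree is at most
  \<open>CARD('k) ^ (m - 1)\<close>.\<close>

lemma ex_Tr_nonzero: "\<exists>x. Tr x \<noteq> 0"
proof (rule ccontr)
  assume "\<nexists>x. Tr x \<noteq> 0"
  then have zero: "conj_sum x = 0" for x
    using emb_Tr[of x] by simp
  let ?p = "(\<Sum>i<m. monom 1 (CARD('k) ^ i)) :: 'l poly"
  have q: "CARD('k) ^ i = 1 \<longleftrightarrow> i = 0" for i
    using CARD_ge_2[where ?'a = 'k] by (auto simp: power_eq_1_iff)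
  have "coeff ?p 1 = (\<Sum>i<m. if i = 0 then 1 else 0)"
    unfolding coeff_sum by (intro sum.cong refl) (use q in auto)
  also have "\<dots> = 1"
    using m_pos by simp
  finally have "?p \<noteq> 0"
    by (metis coeff_0 zero_neq_one)
  then have "card {y. poly ?p y = 0} \<le> degree ?p"
    by (rule card_poly_roots_bound)
  also have "{y. poly ?p y = 0} = UNIV"
    using zero by (simp add: poly_sum poly_monom conj_sum_def)
  also have "degree ?p \<le> CARD('k) ^ (m - 1)"
    by (rule degree_sum_le) (use CARD_ge_2[where ?'a = 'k] m_pos in \<open>auto simp: degree_monom_eq intro!: power_increasing\<close>)
  also have "\<dots> < CARD('k) ^ m"
    using CARD_ge_2[where ?'a = 'k] m_pos by (intro power_strict_increasing) auto
  finally show False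
    by (simp add: CARD_l)
qed

lemma Tr_nondegenerate: "\<forall>x. Tr (x * z) = 0 \<Longrightarrow> z = 0"
proof (rule ccontr)
  assume *: "\<forall>x. Tr (x * z) = 0" and "z \<noteq> 0"
  obtain y where "Tr y \<noteq> 0"
    using ex_Tr_nonzero by blast
  with *[rule_format, of "y / z"] \<open>z \<noteq> 0\<close> show False
    by simp
qed

text \<open>The map x^2 + x sends both 0 and 1 to 0, so on a finite field it misses some value,
  which supplies the \<open>\<alpha>\<close> for the character.\<close>

lemma ex_character: "\<exists>\<psi> :: 'k \<Rightarrow> int. binary_character \<psi>"
proof -
  have two: "(2 :: 'k) = 0"
    by (rule two_eq_0_if_CARD_power2[OF CARD_k])
  have "\<not> inj (\<lambda>x :: 'k. x\<^sup>2 + x)"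
  proof
    assume "inj (\<lambda>x :: 'k. x\<^sup>2 + x)"
    then have "(1 :: 'k) = 0"
      by (rule injD) (simp add: two)
    then show False
      by simp
  qed
  then have "\<not> surj (\<lambda>x :: 'k. x\<^sup>2 + x)"
    using finite_UNIV_surj_inj[OF finite] by blast
  then show ?thesis
    using binary_character_artin_schreier[OF two] by blast
qed

section \<open>Orthogonal complements for the trace form\<close>

definition perp :: "'l set \<Rightarrow> 'l set" where
  "perp U = {x. \<forall>u\<in>U. Tr (x * u) = 0}"

lemma subspace_perp: "subspace (perp U)"
proof (rule subspaceI)
  show "0 \<in> perp U"
    using Tr_scale[of 0 0] by (simp add: perp_def)
qed (simp_all add: perp_def ext_scale_def distrib_right Tr_add Tr_scale mult.assoc)

lemma card_perp:
  assumes "subspace U"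
  shows "card U * card (perp U) = CARD('k) ^ m"
proof -
  obtain \<psi> :: "'k \<Rightarrow> int" where "binary_character \<psi>"
    using ex_character by blast
  then interpret binary_character \<psi> .
  show ?thesis
    unfolding perp_def CARD_l[symmetric]
    by (rule card_orthogonal[OF vector_space_axioms assms, of "\<lambda>x u. Tr (x * u)"])
      (simp_all add: ext_scale_def distrib_left distrib_right Tr_add Tr_scale mult.assoc
        mult.left_commute[of _ "emb _"] Tr_nondegenerate)
qed

lemma card_perp_power:
  assumes "subspace U" "card U = CARD('k) ^ r" "r \<le> m"
  shows "card (perp U) = CARD('k) ^ (m - r)"
proof -
  have "CARD('k) ^ r * card (perp U) = CARD('k) ^ r * CARD('k) ^ (m - r)"
    using card_perp[OF assms(1)] assms(2,3) by (simp flip: power_add)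
  then show ?thesis
    by simp
qed

text \<open>One inclusion is the symmetry of the trace form; comparing cardinalities of complements
  makes it an equality.\<close>

lemma perp_perp:
  assumes W: "subspace W"
  shows "perp (perp W) = W"
proof (rule card_seteq[symmetric])
  show "W \<subseteq> perp (perp W)"
    by (auto simp: perp_def mult.commute)
  have "card (perp W) * card (perp (perp W)) = card (perp W) * card W"
    using card_perp[OF W] card_perp[OF subspace_perp[of W]] by (simp add: mult.commute)
  moreover have "card (perp W) \<noteq> 0"
    using subspace_0[OF subspace_perp] by (auto simp: card_eq_0_iff)
  ultimately show "card (perp (perp W)) \<le> card W"
    by simp
qed simp

section \<open>Codewords, supports of subcodes and generalized weights\<close>

definition codeword :: "'l set \<Rightarrow> 'l \<Rightarrow> 'l \<Rightarrow> 'k" where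
  "codeword D x d = (if d \<in> D then Tr (x * d) else 0)"

lemma trace_code_eq: "trace_code emb m D = range (codeword D)"
  by (simp add: trace_code_def codeword_def[abs_def])

lemma codeword_add: "codeword D (x + y) = codeword D x + codeword D y"
  by (simp add: codeword_def fun_eq_iff distrib_right Tr_add)

lemma codeword_scale: "codeword D (ext_scale emb c x) = fun_scale c (codeword D x)"
  by (simp add: codeword_def fun_eq_iff ext_scale_def fun_scale_def mult.assoc Tr_scale)

lemma codeword_0: "codeword D 0 = 0"
  using codeword_scale[of D 0 0] by (simp add: fun_scale_def fun_eq_iff)

lemma subspace_codeword_image:
  assumes "subspace U"
  shows "words.subspace (codeword D ` U)"
proof (rule words.subspaceI)
  show "0 \<in> codeword D ` U"
    using subspace_0[OF assms] codeword_0 by (metis imageI)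
qed (use assms in \<open>auto simp: codeword_add[symmetric] codeword_scale[symmetric]
    intro!: imageI subspace_add subspace_scale\<close>)

lemma subspace_codeword_vimage:
  assumes "words.subspace H"
  shows "subspace (codeword D -` H)"
  by (rule subspaceI)
    (use assms in \<open>auto simp: codeword_0 codeword_add codeword_scale
      intro: words.subspace_0 words.subspace_add words.subspace_scale\<close>)

text \<open>All words coming from \<open>U\<close> vanish at a position \<open>d\<close> of
  \<open>D\<close> exactly when \<open>d\<close> is orthogonal to \<open>U\<close>.\<close>

lemma code_supp_codeword_image: "code_supp (codeword D ` U) = D - perp U"
  by (auto simp: code_supp_def codeword_def perp_def mult.commute split: if_splits)

context
  fixes D :: "'l set"
  assumes separating: "\<And>x. \<forall>d\<in>D. Tr (x * d) = 0 \<Longrightarrow> x = 0"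
begin

lemma inj_codeword: "inj (codeword D)"
proof (rule injI)
  fix x y assume eq: "codeword D x = codeword D y"
  have "codeword D x = codeword D (x - y) + codeword D y"
    by (simp flip: codeword_add)
  then have "codeword D (x - y) = 0"
    using eq by simp
  then have "\<forall>d\<in>D. Tr ((x - y) * d) = 0"
    unfolding codeword_def fun_eq_iff zero_fun_apply by metis
  then show "x = y"
    using separating[of "x - y"] by simp
qed

lemma subspace_trace_code: "words.subspace (trace_code emb m D)"
  unfolding trace_code_eq by (rule subspace_codeword_image) (rule subspace_UNIV)

lemma words_dim_eq_iff:
  assumes "words.subspace H" "finite H"
  shows "words.dim H = r \<longleftrightarrow> card H = CARD('k) ^ r"
  using card_subspace[OF vector_space_fun_scale assms] CARD_ge_2[where ?'a = 'k] by (simp add: power_inject_exp)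

lemma dim_trace_code: "words.dim (trace_code emb m D) = m"
  using words_dim_eq_iff[OF subspace_trace_code, of m]
  by (simp add: trace_code_eq card_image[OF inj_codeword] CARD_l)

text \<open>Injective encoding identifies subcodes of dimension \<open>r\<close> with subspaces
  \<open>U\<close> of dimension \<open>r\<close>, and \<open>perp U\<close> has dimension
  \<open>m - r\<close>; by \<open>perp_perp\<close> every such \<open>W\<close> occurs.\<close>

lemma code_supp_card_set:
  assumes r: "r \<le> m"
  shows "{card (code_supp H) | H. words.subspace H \<and> H \<subseteq> trace_code emb m D \<and> words.dim H = r}
    = {card (D - W) | W. subspace W \<and> card W = CARD('k) ^ (m - r)}" (is "?L = ?R")
proof (intro equalityI subsetI)
  fix n assume "n \<in> ?L"
  then obtain H where H: "n = card (code_supp H)" "words.subspace H" "H \<subseteq> range (codeword D)"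
      "words.dim H = r"
    unfolding trace_code_eq by blast
  let ?U = "codeword D -` H"
  have im: "H = codeword D ` ?U"
    using H(3) by blast
  have U: "subspace ?U"
    using subspace_codeword_vimage[OF H(2)] .
  have "finite H"
    by (rule finite_subset[OF H(3)]) simp
  then have "card ?U = CARD('k) ^ r"
    using words_dim_eq_iff[OF H(2), of r] H(4) card_vimage_inj[OF inj_codeword H(3)] by simp
  then have "card (perp ?U) = CARD('k) ^ (m - r)"
    by (rule card_perp_power[OF U _ r])
  moreover have "n = card (D - perp ?U)"
    using H(1) code_supp_codeword_image[of D ?U, folded im] by simp
  ultimately show "n \<in> ?R"
    using subspace_perp[of ?U] by blast
next
  fix n assume "n \<in> ?R"
  then obtain W where W: "n = card (D - W)" "subspace W" "card W = CARD('k) ^ (m - r)"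
    by blast
  let ?H = "codeword D ` perp W"
  have H: "words.subspace ?H"
    by (rule subspace_codeword_image) (rule subspace_perp)
  have "card (perp W) = CARD('k) ^ r"
    using card_perp_power[OF W(2,3)] r by simp
  then have "card ?H = CARD('k) ^ r"
    using card_image[OF inj_on_subset[OF inj_codeword subset_UNIV]] by simp
  then have "words.dim ?H = r"
    using words_dim_eq_iff[OF H] by simp
  moreover have "n = card (code_supp ?H)"
    unfolding code_supp_codeword_image perp_perp[OF W(2)] by (rule W(1))
  moreover have "?H \<subseteq> trace_code emb m D"
    by (auto simp: trace_code_eq)
  ultimately show "n \<in> ?L"
    using H by blast
qed

text \<open>Minimising \<open>card (D - W)\<close> means maximising
  \<open>card (D \<inter> W)\<close>. Integers avoid truncated subtraction.\<close>

lemma gen_hamming_weight_eq: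
  assumes r: "r \<le> m"
    and le: "\<And>W. subspace W \<Longrightarrow> card W = CARD('k) ^ (m - r) \<Longrightarrow> card (D \<inter> W) \<le> M"
    and ex: "\<exists>W. subspace W \<and> card W = CARD('k) ^ (m - r) \<and> card (D \<inter> W) = M"
  shows "int (gen_hamming_weight (trace_code emb m D) r) = int (card D) - int M"
proof -
  have diff: "int (card (D - W)) = int (card D) - int (card (D \<inter> W))" for W
    by (subst card_Diff_subset_Int) (simp_all add: of_nat_diff card_mono)
  let ?R = "{card (D - W) | W. subspace W \<and> card W = CARD('k) ^ (m - r)}"
  obtain W where W: "subspace W" "card W = CARD('k) ^ (m - r)" "card (D \<inter> W) = M"
    using ex by blast
  have "Min ?R = card (D - W)"
  proof (rule Min_eqI)
    show "finite ?R"
      by simp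
    show "card (D - W) \<in> ?R"
      using W by blast
    fix n assume "n \<in> ?R"
    then obtain V where V: "n = card (D - V)" "subspace V" "card V = CARD('k) ^ (m - r)"
      by blast
    have "int (card (D - W)) \<le> int (card (D - V))"
      unfolding diff using le[OF V(2,3)] W(3) by simp
    then show "card (D - W) \<le> n"
      using V(1) by simp
  qed
  then show ?thesis
    unfolding gen_hamming_weight_def code_supp_card_set[OF r] by (simp add: diff W(3))
qed

end

end

section \<open>The weight hierarchy, from the normal form of a Type II form\<close>

theorem theorem2:
  fixes emb :: "'k::{field,finite} \<Rightarrow> 'l::{field,finite}"
    and q s m :: nat
    and \<epsilon> :: "nat \<Rightarrow> 'l"
    and f :: "'l \<Rightarrow> 'k"
    and a :: 'k
    and C :: "('l \<Rightarrow> 'k) set"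
  assumes "q = 2 ^ s" and "0 < s"
    and "0 < m" and "even m"
    and "CARD('k) = q" and "CARD('l) = q ^ m"
    and "field_embedding emb"
    and "indexed_basis emb m \<epsilon>"
    and "a \<noteq> 0"
    and "quadratic_form emb m \<epsilon> f"
    and "nondegenerate f"
    and "is_type_II emb m \<epsilon> f"
    and "C = trace_code emb m (defining_set f a)"
  shows "module.subspace fun_scale C \<and> vector_space.dim fun_scale C = m \<and>
    (\<forall>r\<in>{1..m}. int (gen_hamming_weight C r) =
       (if r \<le> m div 2 - 1 then int q ^ (m - 1) - int q ^ (m - r - 1)
        else if r < m - 1 then
          int q ^ (m - 1) + int q ^ ((m - 2) div 2) - int q ^ (m - r - 1) - int q ^ (m - r - 2)
        else if r = m - 1 then int q ^ (m - 1) + int q ^ ((m - 2) div 2) - 1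
        else int q ^ (m - 1) + int q ^ ((m - 2) div 2)))"
proof -
  interpret char2_field_extension emb s m
    using assms by unfold_locales simp_all
  define h where "h = m div 2"
  have m: "m = 2 * h" and h: "0 < h"
    using assms(3,4) by (auto simp: h_def)
  \<comment> \<open>Nondegeneracy makes the rank the full \<open>m\<close>, so the normal form uses
    all coordinates.\<close>
  have "dim {0 :: 'l} = 0"
    using dim_span_eq_card_independent[OF independent_empty] by simp
  then have rank: "form_rank emb m f = m"
    using assms(11) by (simp add: form_rank_def nondegenerate_def)
  obtain \<alpha> T where \<alpha>: "\<alpha> \<notin> range (\<lambda>x :: 'k. x\<^sup>2 + x)"
    and T: "Vector_Spaces.linear (ext_scale emb) (ext_scale emb) T" "bij T"
      "\<And>x. f x = type_II_poly m \<alpha> (coordinate emb m \<epsilon> (T x))"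
    using assms(12) unfolding is_type_II_def rank form_equiv_def by blast
  interpret T: Vector_Spaces.linear "ext_scale emb" "ext_scale emb" T
    by (rule T(1))
  define Q where "Q = range (\<lambda>x :: 'k. x\<^sup>2 + x)"
  define \<psi> :: "'k \<Rightarrow> int" where "\<psi> = (\<lambda>c. if c \<in> Q then 1 else - 1)"
  \<comment> \<open>Coordinates after the change of variables \<open>T\<close>, in which
    \<open>f\<close> has its normal form.\<close>
  define y where "y x = coordinate emb m \<epsilon> (T x)" for x
  define P where "P x i = (y x (2 * i - 1), y x (2 * i))" for x i
  have ind: "independent (\<epsilon> ` {1..m})" and span: "span (\<epsilon> ` {1..m}) = UNIV"
    and inj_\<epsilon>: "inj_on \<epsilon> {1..m}"
    using assms(8) by (simp_all add: indexed_basis_def)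
  have y_add: "y (u + v) i = y u i + y v i" for u v i
    unfolding y_def coordinate_def T.add
    by (subst representation_add[OF ind]) (simp_all only: span UNIV_I)
  have y_scale: "y (ext_scale emb c u) i = c * y u i" for c u i
    unfolding y_def coordinate_def T.scale
    by (subst representation_scale[OF ind]) (simp_all only: span UNIV_I)
  have y_inj: "u = v" if "\<And>i. i \<in> {1..m} \<Longrightarrow> y u i = y v i" for u v
  proof -
    have "T u = (\<Sum>b\<in>\<epsilon> ` {1..m}. ext_scale emb (representation (\<epsilon> ` {1..m}) (T u) b) b)"
      by (rule sum_representation_eq[symmetric]) (simp_all only: ind span UNIV_I not_False_eq_True finite_imageI finite_atLeastAtMost order_refl)
    also have "\<dots> = (\<Sum>b\<in>\<epsilon> ` {1..m}. ext_scale emb (representation (\<epsilon> ` {1..m}) (T v) b) b)"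
      using that by (intro sum.cong refl) (auto simp: y_def coordinate_def)
    also have "\<dots> = T v"
      by (rule sum_representation_eq) (simp_all only: ind span UNIV_I not_False_eq_True finite_imageI finite_atLeastAtMost order_refl)
    finally show ?thesis
      using T(2) by (simp add: bij_def inj_eq)
  qed
  interpret elliptic_space "ext_scale emb" \<psi> P h \<alpha>
  proof -
    interpret binary_character \<psi>
      unfolding \<psi>_def Q_def
      by (rule binary_character_artin_schreier[OF two_eq_0_if_CARD_power2[OF CARD_k] \<alpha>])
    have "inj (\<lambda>x. restrict (P x) {1..h})"
    proof (rule injI)
      fix u v assume eq: "restrict (P u) {1..h} = restrict (P v) {1..h}"
      have P: "P u i = P v i" if "i \<in> {1..h}" for i
        using fun_cong[OF eq, of i] that by simp
      show "u = v"
      proof (rule y_inj)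
        fix i assume "i \<in> {1..m}"
        \<comment> \<open>Pair \<open>j\<close> holds the coordinates \<open>2 * j - 1\<close> and
          \<open>2 * j\<close>, so coordinate \<open>i\<close> sits in pair
          \<open>(i + 1) div 2\<close>.\<close>
        then have "(i + 1) div 2 \<in> {1..h}"
          by (auto simp: m)
        from P[OF this] show "y u i = y v i"
          using \<open>i \<in> {1..m}\<close> by (cases "even i") (auto simp: P_def elim!: evenE oddE)
      qed
    qed
    \<comment> \<open>Both sides have \<open>CARD('k) ^ (2 * h)\<close> elements, so injectivity
      forces the full range.\<close>
    moreover have "card (range (\<lambda>x. restrict (P x) {1..h})) = card ({1..h} \<rightarrow>\<^sub>E (UNIV :: ('k \<times> 'k) set))"
      unfolding card_image[OF calculation]
      by (simp add: CARD_l card_PiE m power_mult power2_eq_square)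
    then have "range (\<lambda>x. restrict (P x) {1..h}) = ({1..h} \<rightarrow>\<^sub>E UNIV)"
      by (intro card_subset_eq finite_PiE) auto
    ultimately have "bij_betw (\<lambda>x. restrict (P x) {1..h}) UNIV ({1..h} \<rightarrow>\<^sub>E UNIV)"
      by (simp add: bij_betw_def)
    then show "elliptic_space (ext_scale emb) \<psi> P h \<alpha>"
      using h \<alpha> by unfold_locales (simp_all add: \<psi>_def Q_def P_def y_add y_scale)
  qed
  have f_eq: "f = form"
  proof
    fix x
    \<comment> \<open>The first \<open>h - 1\<close> pairs are hyperbolic; coordinates
      \<open>m - 1\<close> and \<open>m\<close> form the anisotropic pair \<open>h\<close>.\<close>
    have "(\<Sum>i = 1..(m - 2) div 2. y x (2 * i - 1) * y x (2 * i)) = (\<Sum>i = 1..h - 1. pair_form i (P x i))"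
      by (intro sum.cong) (auto simp: m pair_form_def P_def)
    moreover have "{1..h} = insert h {1..h - 1}"
      using h by auto
    ultimately show "f x = form x"
      unfolding T(3) type_II_poly_def form_def y_def[symmetric]
      using h by (simp add: pair_form_def P_def m add.assoc add.commute)
  qed
  let ?D = "defining_set f a"
  have q: "q = CARD('k)"
    using assms(5) by simp
  have level: "card (?D \<inter> W) = card {x \<in> W. form x = a}" for W
    by (rule arg_cong[of _ _ card]) (auto simp: defining_set_def f_eq)
  have D: "card ?D = max_points q h m"
    using card_level[OF assms(9)] by (simp add: defining_set_def f_eq m q)
  \<comment> \<open>A nonzero \<open>x\<close> orthogonal to \<open>?D\<close> would place
    \<open>?D\<close> in the hyperplane \<open>perp ?L\<close>, which holds too few points of the
    level set. So encoding is injective and the code has dimension \<open>m\<close>.\<close>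
  have separating: "x = 0" if x: "\<forall>d\<in>?D. Tr (x * d) = 0" for x
  proof (rule ccontr)
    assume "x \<noteq> 0"
    have L: "subspace (range (\<lambda>c. ext_scale emb c x))" (is "subspace ?L")
      by (metis span_singleton subspace_span)
    have "inj (\<lambda>c. ext_scale emb c x)"
      using \<open>x \<noteq> 0\<close> by (simp add: inj_def)
    then have "card ?L = CARD('k) ^ 1"
      by (simp add: card_image)
    then have "card (perp ?L) = CARD('k) ^ (m - 1)"
      using card_perp_power[OF L] h m by simp
    then have "card {y \<in> perp ?L. form y = a} \<le> max_points q h (m - 1)"
      unfolding q by (rule card_level_le_max_points[OF subspace_perp _ assms(9)])
    moreover have "?D \<subseteq> perp ?L"
    proof
      fix d assume "d \<in> ?D"
      then have "Tr (emb c * (x * d)) = 0" for c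
        using x by (simp add: Tr_scale)
      then show "d \<in> perp ?L"
        by (simp add: perp_def ext_scale_def ac_simps)
    qed
    then have "?D \<inter> perp ?L = ?D"
      by blast
    ultimately have le: "max_points q h m \<le> max_points q h (m - 1)"
      using D level[of "perp ?L"] by simp
    have "2 \<le> q"
      unfolding q by (rule CARD_ge_2[where ?'a = 'k])
    from max_points_hyperplane_less[OF this h] le show False
      unfolding m by simp
  qed
  have weight: "int (gen_hamming_weight C r) = int (max_points q h m) - int (max_points q h (m - r))"
    if "r \<in> {1..m}" for r
    unfolding assms(13) D[symmetric]
    by (rule gen_hamming_weight_eq[OF separating])
      (use that ex_card_level_eq_max_points[of "m - r" a] card_level_le_max_points[of _ "m - r" a] assms(9)
        in \<open>auto simp: level m q\<close>)
  show ?thesis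
  proof (intro conjI ballI)
    show "words.subspace C" "words.dim C = m"
      unfolding assms(13) using subspace_trace_code[OF separating] dim_trace_code[OF separating] by blast+
    fix r assume r: "r \<in> {1..m}"
    have half: "(m - 2) div 2 = h - 1" "m div 2 = h"
      by (simp_all add: m)
    have top: "int (max_points q h m) = int q ^ (m - 1) + int q ^ (h - 1)"
      using h by (simp add: max_points_def m)
    \<comment> \<open>These ranges are the branches of \<open>max_points\<close> at
      \<open>m - r\<close>: \<open>r \<le> h - 1\<close> amounts to \<open>h < m - r\<close>, while
      \<open>r = m - 1\<close> and \<open>r = m\<close> give 1 and 0 points.\<close>
    consider "r \<le> h - 1" | "\<not> r \<le> h - 1" "r < m - 1" | "\<not> r \<le> h - 1" "r = m - 1" | "\<not> r \<le> h - 1" "r = m"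
      using r by fastforce
    then show "int (gen_hamming_weight C r) =
       (if r \<le> m div 2 - 1 then int q ^ (m - 1) - int q ^ (m - r - 1)
        else if r < m - 1 then
          int q ^ (m - 1) + int q ^ ((m - 2) div 2) - int q ^ (m - r - 1) - int q ^ (m - r - 2)
        else if r = m - 1 then int q ^ (m - 1) + int q ^ ((m - 2) div 2) - 1
        else int q ^ (m - 1) + int q ^ ((m - 2) div 2))"
    proof cases
      case 1
      then have "h < m - r"
        using r m by auto
      then have "max_points q h (m - r) = q ^ (m - r - 1) + q ^ (h - 1)"
        by (simp add: max_points_def)
      then show ?thesis
        using 1 weight[OF r] top half by simp
    next
      case 2
      then have "\<not> h < m - r" "2 \<le> m - r"
        using m by auto
      then have "max_points q h (m - r) = q ^ (m - r - 1) + q ^ (m - r - 2)"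
        by (simp add: max_points_def)
      then show ?thesis
        using 2 h weight[OF r] top half by simp
    next
      case 3
      then have "m - r = 1"
        using m h by auto
      then have "max_points q h (m - r) = 1"
        using h by (simp add: max_points_def)
      then show ?thesis
        using 3 h weight[OF r] top half by simp
    next
      case 4
      then have "\<not> r < m - 1" "r \<noteq> m - 1"
        using assms(3) by auto
      moreover have "max_points q h (m - r) = 0"
        using 4 by (simp add: max_points_def)
      ultimately show ?thesis
        using 4 weight[OF r] top half by simp
    qed
  qed
qed

end
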